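(* Let $m$ be a positive integer and $\omega\in\mathbb{R}$. (a) For $\boldsymbol{\zeta}\in\Psi^{(m)}$, the element $x^m-g_{\boldsymbol{\zeta}}\in R$ is left irreducible if and only if the orbit $\mathbf{C}_m\cdot\boldsymbol{\zeta}$ is regular. (b) For two regular $\boldsymbol{\zeta},\boldsymbol{\zeta}'\in\Psi^{(m)}$, the elements $x^m-g_{\boldsymbol{\zeta}}$ and $x^m-g_{\boldsymbol{\zeta}'}$ are similar if and only if $\boldsymbol{\zeta}\in\mathbf{C}_m\cdot\boldsymbol{\zeta}'$. (c) If $\beta\in\mathbb{C}(\mathtt{h})$ is such that $x^m-\beta$ is left irreducible, then there is $\boldsymbol{\zeta}\in\Psi^{(m)}$ such that $x^m-\beta$ and $x^m-g_{\boldsymbol{\zeta}}$ are similar.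
   Context: $R=\mathbb{C}(\mathtt{h})[x,x^{-1},\sigma]$ is the skew Laurent polynomial algebra: the free left $\mathbb{C}(\mathtt{h})$-module with basis $x^i$, $i\in\mathbb{Z}$, with $x^ix^j=x^{i+j}$ and $xa=\sigma(a)x$ for $a\in\mathbb{C}(\mathtt{h})$, where $\sigma$ is the $\mathbb{C}$-automorphism of $\mathbb{C}(\mathtt{h})$ with $\sigma(\mathtt{h})=\mathtt{h}-2$. A non-zero non-invertible $a\in R$ is left irreducible if $Ra$ is a maximal left ideal, i.e. $R/Ra$ is a simple $R$-module. Left irreducible elements $a,b$ are similar if $R/Ra\cong R/Rb$ as $R$-modules. $\Omega_\omega$ is the set of complex numbers with real part in $[\omega,\omega+2)$. $\Psi^{(m)}$ is the set of tuples $\boldsymbol{\zeta}=(c,\zeta_0,\dots,\zeta_{m-1})$ with $c\in\mathbb{C}^\times$ and each $\zeta_i:\Omega_\omega\to\mathbb{Z}$ a function with finite support. Put $$g_{\boldsymbol{\zeta}}(\mathtt{h})=c\prod_{i=0}^{m-1}\prod_{\lambda\in\Omega_\omega}(\mathtt{h}-\lambda-2i)^{\zeta_i(\lambda)}\in\mathbb{C}(\mathtt{h}).$$ The cyclic group $\mathbf{C}_m=\mathbb{Z}/m\mathbb{Z}$ acts on $\Psi^{(m)}$: $k\in\mathbf{C}_m$ fixes $c$ and maps $\zeta_i$ to $\zeta_{i+k}$, indices modulo $m$. An orbit is regular if it has $m$ different elements; $\boldsymbol{\zeta}$ is regular if its orbit is. *)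

theory Defs
  imports
    "HOL-Computational_Algebra.Computational_Algebra"
    "HOL-Computational_Algebra.Field_as_Ring"
    "HOL-Algebra.Ideal"
    "HOL-Algebra.Module"
    "HOL-Algebra.Elementary_Groups"
    "HOL-Algebra.Group_Action"
begin

section \<open>Left ideals and cyclic left modules over a noncommutative ring\<close>

locale left_ideal = additive_subgroup I R + ring R for I and R (structure) +
  assumes I_l_closed: "\<lbrakk>a \<in> I; r \<in> carrier R\<rbrakk> \<Longrightarrow> r \<otimes> a \<in> I"

locale maximal_left_ideal = left_ideal +
  assumes I_notcarr: "carrier R \<noteq> I"
    and I_maximal: "\<lbrakk>left_ideal J R; I \<subseteq> J\<rbrakk> \<Longrightarrow> J = I \<or> J = carrier R"

definition left_principal :: "('a, 'm) ring_scheme \<Rightarrow> 'a \<Rightarrow> 'a set" where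
  "left_principal R a = {r \<otimes>\<^bsub>R\<^esub> a | r. r \<in> carrier R}"

definition left_irreducible :: "('a, 'm) ring_scheme \<Rightarrow> 'a \<Rightarrow> bool" where
  "left_irreducible R a \<longleftrightarrow>
     a \<in> carrier R \<and> a \<noteq> \<zero>\<^bsub>R\<^esub> \<and> a \<notin> Units R \<and> maximal_left_ideal (left_principal R a) R"

text \<open>The left module \<open>R/I\<close>. A module record extends a ring record; as the modules here have no
  internal multiplication, the fields \<open>mult\<close> and \<open>one\<close> are irrelevant. The locale
  \<^locale>\<open>module\<close> is not used because it requires commutative scalars.\<close>

definition left_quotient ::
    "('a, 'm) ring_scheme \<Rightarrow> 'a set \<Rightarrow> ('a, 'a set) module" where
  "left_quotient R I =
     \<lparr>carrier = a_rcosets\<^bsub>R\<^esub> I, mult = undefined, one = undefined,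
      zero = I, add = set_add R,
      smult = (\<lambda>r X. \<Union>y\<in>X. I +>\<^bsub>R\<^esub> (r \<otimes>\<^bsub>R\<^esub> y))\<rparr>"

lemma (in left_ideal) left_quotient_add:
  assumes "x \<in> carrier R" "y \<in> carrier R"
  shows "(I +> x) \<oplus>\<^bsub>left_quotient R I\<^esub> (I +> y) = I +> (x \<oplus> y)"
proof -
  interpret S: abelian_subgroup I R
    by (rule abelian_subgroupI3) (unfold_locales)
  show ?thesis
    using S.a_rcos_sum[OF assms] by (simp add: left_quotient_def)
qed

lemma (in left_ideal) left_quotient_smult:
  assumes r: "r \<in> carrier R" and y: "y \<in> carrier R"
  shows "r \<odot>\<^bsub>left_quotient R I\<^esub> (I +> y) = I +> (r \<otimes> y)"
proof -
  interpret S: abelian_subgroup I R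
    by (rule abelian_subgroupI3) (unfold_locales)
  have eq: "I +> (r \<otimes> z) = I +> (r \<otimes> y)" if z: "z \<in> I +> y" for z
  proof -
    obtain i where i: "i \<in> I" "z = i \<oplus> y"
      using z unfolding a_r_coset_def' by auto
    have iR: "i \<in> carrier R" using i a_subset by auto
    have "r \<otimes> z = r \<otimes> i \<oplus> r \<otimes> y" using i iR r y by (simp add: r_distr)
    then have "r \<otimes> z \<in> I +> (r \<otimes> y)"
      using I_l_closed[OF i(1) r] unfolding a_r_coset_def' by auto
    then show ?thesis
      by (intro S.a_repr_independence'[symmetric] m_closed r y a_subgroup)
  qed
  have "r \<odot>\<^bsub>left_quotient R I\<^esub> (I +> y) = (\<Union>z\<in>I +> y. I +> (r \<otimes> z))"
    by (simp add: left_quotient_def)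
  also have "\<dots> = (\<Union>z\<in>I +> y. I +> (r \<otimes> y))"
    by (rule SUP_cong[OF refl eq])
  also have "\<dots> = I +> (r \<otimes> y)"
    using S.a_rcos_self[OF y] by blast
  finally show ?thesis .
qed

definition left_module_iso ::
    "('a, 'm) ring_scheme \<Rightarrow> ('a, 'b, 'n) module_scheme \<Rightarrow> ('a, 'c, 'k) module_scheme \<Rightarrow> bool" where
  "left_module_iso R M N \<longleftrightarrow>
     (\<exists>f. bij_betw f (carrier M) (carrier N)
        \<and> (\<forall>u\<in>carrier M. \<forall>v\<in>carrier M. f (u \<oplus>\<^bsub>M\<^esub> v) = f u \<oplus>\<^bsub>N\<^esub> f v)
        \<and> (\<forall>r\<in>carrier R. \<forall>u\<in>carrier M. f (r \<odot>\<^bsub>M\<^esub> u) = r \<odot>\<^bsub>N\<^esub> f u))"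

definition left_similar :: "('a, 'm) ring_scheme \<Rightarrow> 'a \<Rightarrow> 'a \<Rightarrow> bool" where
  "left_similar R a b \<longleftrightarrow>
     left_irreducible R a \<and> left_irreducible R b \<and>
     left_module_iso R (left_quotient R (left_principal R a)) (left_quotient R (left_principal R b))"


section \<open>Skew Laurent polynomials over a field\<close>

definition int_iter :: "('a \<Rightarrow> 'a) \<Rightarrow> int \<Rightarrow> 'a \<Rightarrow> 'a" where
  "int_iter s i = (if 0 \<le> i then s ^^ nat i else (inv_into UNIV s) ^^ nat (- i))"

text \<open>The element \<open>f\<close> stands for the sum of the \<open>f i x\<^sup>i\<close>, coefficients on the left. The product is
  forced by \<open>x\<^sup>i a = \<sigma>\<^sup>i(a) x\<^sup>i\<close>.\<close>

definition skew_laurent :: "('a::field \<Rightarrow> 'a) \<Rightarrow> (int \<Rightarrow> 'a) ring" where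
  "skew_laurent s =
     \<lparr>carrier = {f. finite {i. f i \<noteq> 0}},
      mult = (\<lambda>f g n. \<Sum>i | f i \<noteq> 0. f i * int_iter s i (g (n - i))),
      one = (\<lambda>n. if n = 0 then 1 else 0),
      zero = (\<lambda>n. 0),
      add = (\<lambda>f g n. f n + g n)\<rparr>"

definition sl_const :: "'a::field \<Rightarrow> int \<Rightarrow> 'a" where
  "sl_const a = (\<lambda>n. if n = 0 then a else 0)"

definition sl_var :: "int \<Rightarrow> 'a::field" where
  "sl_var = (\<lambda>n. if n = 1 then 1 else 0)"

locale field_aut =
  fixes s :: "'a::field \<Rightarrow> 'a"
  assumes bij_s: "bij s"
    and s_add: "s (a + b) = s a + s b"
    and s_mult: "s (a * b) = s a * s b"
begin

lemma s_0: "s 0 = 0"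
proof -
  have "s 0 = s 0 + s 0" using s_add[of 0 0] by simp
  then show ?thesis by (metis add_cancel_right_right)
qed

lemma s_1: "s 1 = 1"
proof -
  have "s 1 \<noteq> 0" using s_0 bij_s by (metis bij_is_inj injD zero_neq_one)
  then show ?thesis using s_mult[of 1 1] by simp
qed

lemma field_aut_inv: "field_aut (inv_into UNIV s)"
proof
  show "bij (inv_into UNIV s)" using bij_s by (rule bij_imp_bij_inv)
  note [simp] = bij_is_inj[OF bij_s] surj_f_inv_f[OF bij_is_surj[OF bij_s]]
  fix a b
  show "inv_into UNIV s (a + b) = inv_into UNIV s a + inv_into UNIV s b"
    by (rule inv_f_eq) (simp_all add: s_add)
  show "inv_into UNIV s (a * b) = inv_into UNIV s a * inv_into UNIV s b"
    by (rule inv_f_eq) (simp_all add: s_mult)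
qed

lemma field_aut_funpow: "field_aut (s ^^ n)"
proof
  show "bij (s ^^ n)" using bij_s by (rule bij_fn)
  fix a b
  show "(s ^^ n) (a + b) = (s ^^ n) a + (s ^^ n) b"
    by (induction n) (simp_all add: s_add)
  show "(s ^^ n) (a * b) = (s ^^ n) a * (s ^^ n) b"
    by (induction n) (simp_all add: s_mult)
qed

lemma field_aut_iter: "field_aut (int_iter s i)"
  unfolding int_iter_def
  using field_aut_funpow field_aut.field_aut_funpow[OF field_aut_inv] by simp

lemma iter_0 [simp]: "int_iter s 0 = id"
  by (simp add: int_iter_def)

lemma iter_1 [simp]: "int_iter s 1 = s"
  by (simp add: int_iter_def)

lemma iter_zero [simp]: "int_iter s i 0 = 0"
  using field_aut.s_0[OF field_aut_iter] .

lemma iter_one [simp]: "int_iter s i 1 = 1"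
  using field_aut.s_1[OF field_aut_iter] .

lemma iter_plus: "int_iter s i (a + b) = int_iter s i a + int_iter s i b"
  using field_aut.s_add[OF field_aut_iter] .

lemma iter_times: "int_iter s i (a * b) = int_iter s i a * int_iter s i b"
  using field_aut.s_mult[OF field_aut_iter] .

lemma iter_sum: "int_iter s i (sum f A) = (\<Sum>k\<in>A. int_iter s i (f k))"
  by (induction A rule: infinite_finite_induct) (simp_all add: iter_plus)

lemma iter_Suc: "int_iter s (i + 1) a = s (int_iter s i a)"
proof (cases "0 \<le> i")
  case True
  then show ?thesis by (simp add: int_iter_def nat_add_distrib)
next
  case False
  then have "nat (- i) = Suc (nat (- (i + 1)))" by simp
  with False show ?thesis
    by (auto simp: int_iter_def surj_f_inv_f[OF bij_is_surj[OF bij_s]])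
qed

lemma iter_add: "int_iter s (i + j) a = int_iter s i (int_iter s j a)"
proof (induction i rule: int_induct[where k = 0])
  case base
  then show ?case by simp
next
  case (step1 i)
  then show ?case using iter_Suc[of "i + j"] iter_Suc[of i] by (simp add: algebra_simps)
next
  case (step2 i)
  have "s (int_iter s (i - 1 + j) a) = s (int_iter s (i - 1) (int_iter s j a))"
    using step2 iter_Suc[of "i - 1 + j"] iter_Suc[of "i - 1"] by (simp add: algebra_simps)
  then show ?case using bij_s by (metis bij_is_inj injD)
qed

lemma sl_mult_eq:
  assumes "finite A" "{i. f i \<noteq> 0} \<subseteq> A"
  shows "mult (skew_laurent s) f g n = (\<Sum>i\<in>A. f i * int_iter s i (g (n - i)))"
  unfolding skew_laurent_def using assms by (auto intro!: sum.mono_neutral_left)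

lemma sl_mult_supp:
  "{n. mult (skew_laurent s) f g n \<noteq> 0} \<subseteq> (\<lambda>(i, j). i + j) ` ({i. f i \<noteq> 0} \<times> {j. g j \<noteq> 0})"
proof
  fix n assume "n \<in> {n. mult (skew_laurent s) f g n \<noteq> 0}"
  then have "(\<Sum>i | f i \<noteq> 0. f i * int_iter s i (g (n - i))) \<noteq> 0"
    by (simp add: skew_laurent_def)
  then obtain i where i: "f i \<noteq> 0" "f i * int_iter s i (g (n - i)) \<noteq> 0"
    by (elim sum.not_neutral_contains_not_neutral) simp
  then have "g (n - i) \<noteq> 0" by auto
  with i show "n \<in> (\<lambda>(i, j). i + j) ` ({i. f i \<noteq> 0} \<times> {j. g j \<noteq> 0})"
    by (auto intro!: image_eqI[of _ _ "(i, n - i)"])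
qed

lemma sl_assoc:
  assumes f: "finite {i. f i \<noteq> 0}" and g: "finite {i. g i \<noteq> 0}"
  defines "m \<equiv> mult (skew_laurent s)"
  shows "m (m f g) h = m f (m g h)"
proof
  fix n
  let ?A = "{i. f i \<noteq> 0}" and ?B = "{i. g i \<noteq> 0}"
  let ?P = "(\<lambda>(i, j). i + j) ` (?A \<times> ?B)"
  let ?I = "int_iter s"
  have finP: "finite ?P" using f g by auto
  have mfg: "m f g k = (\<Sum>i\<in>?A. f i * ?I i (g (k - i)))" for k
    unfolding m_def by (rule sl_mult_eq) (use f in auto)
  have mgh: "m g h k = (\<Sum>j\<in>?B. g j * ?I j (h (k - j)))" for k
    unfolding m_def by (rule sl_mult_eq) (use g in auto)
  have "m (m f g) h n = (\<Sum>k\<in>?P. m f g k * ?I k (h (n - k)))"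
    unfolding m_def by (rule sl_mult_eq[OF finP sl_mult_supp])
  also have "\<dots> = (\<Sum>i\<in>?A. \<Sum>k\<in>?P. f i * ?I i (g (k - i)) * ?I k (h (n - k)))"
    unfolding mfg sum_distrib_right by (rule sum.swap)
  also have "\<dots> = (\<Sum>i\<in>?A. \<Sum>j\<in>?B. f i * ?I i (g j) * ?I (i + j) (h (n - (i + j))))"
  proof (rule sum.cong[OF refl])
    fix i assume i: "i \<in> ?A"
    have "(\<Sum>k\<in>?P. f i * ?I i (g (k - i)) * ?I k (h (n - k)))
        = (\<Sum>k\<in>(+) i ` ?B. f i * ?I i (g (k - i)) * ?I k (h (n - k)))"
    proof (rule sum.mono_neutral_right[OF finP])
      show "(+) i ` ?B \<subseteq> ?P" using i by force
      show "\<forall>k\<in>?P - (+) i ` ?B. f i * ?I i (g (k - i)) * ?I k (h (n - k)) = 0"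
      proof
        fix k assume "k \<in> ?P - (+) i ` ?B"
        then have "g (k - i) = 0"
          by (auto simp: image_iff)
        then show "f i * ?I i (g (k - i)) * ?I k (h (n - k)) = 0" by simp
      qed
    qed
    also have "\<dots> = (\<Sum>j\<in>?B. f i * ?I i (g j) * ?I (i + j) (h (n - (i + j))))"
      by (subst sum.reindex) auto
    finally show "(\<Sum>k\<in>?P. f i * ?I i (g (k - i)) * ?I k (h (n - k)))
        = (\<Sum>j\<in>?B. f i * ?I i (g j) * ?I (i + j) (h (n - (i + j))))" .
  qed
  also have "\<dots> = (\<Sum>i\<in>?A. f i * ?I i (m g h (n - i)))"
    by (simp add: mgh iter_sum iter_times iter_add sum_distrib_left mult.assoc algebra_simps)
  also have "\<dots> = m f (m g h) n"
    unfolding m_def by (rule sl_mult_eq[symmetric]) (use f in auto)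
  finally show "m (m f g) h n = m f (m g h) n" .
qed

theorem ring_skew_laurent: "ring (skew_laurent s)"
proof (rule ringI)
  show "abelian_group (skew_laurent s)"
  proof (rule abelian_groupI)
    fix f g assume "f \<in> carrier (skew_laurent s)" "g \<in> carrier (skew_laurent s)"
    then have "finite ({i. f i \<noteq> 0} \<union> {i. g i \<noteq> 0})" by (simp add: skew_laurent_def)
    then have "finite {i. f i + g i \<noteq> 0}" by (rule rev_finite_subset) auto
    then show "f \<oplus>\<^bsub>skew_laurent s\<^esub> g \<in> carrier (skew_laurent s)"
      by (simp add: skew_laurent_def)
  next
    fix f assume "f \<in> carrier (skew_laurent s)"
    then show "\<exists>g\<in>carrier (skew_laurent s). g \<oplus>\<^bsub>skew_laurent s\<^esub> f = \<zero>\<^bsub>skew_laurent s\<^esub>"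
      by (intro bexI[of _ "\<lambda>n. - f n"]) (auto simp: skew_laurent_def)
  qed (auto simp: skew_laurent_def add_ac)
  show "Group.monoid (skew_laurent s)"
  proof (rule monoidI)
    fix f g assume "f \<in> carrier (skew_laurent s)" "g \<in> carrier (skew_laurent s)"
    then have "finite ((\<lambda>(i, j). i + j) ` ({i. f i \<noteq> 0} \<times> {j. g j \<noteq> 0}))"
      by (simp add: skew_laurent_def)
    from finite_subset[OF sl_mult_supp this]
    show "f \<otimes>\<^bsub>skew_laurent s\<^esub> g \<in> carrier (skew_laurent s)"
      by (simp add: skew_laurent_def)
  next
    show "\<one>\<^bsub>skew_laurent s\<^esub> \<in> carrier (skew_laurent s)"
      by (simp add: skew_laurent_def)
  next
    fix f g h
    assume "f \<in> carrier (skew_laurent s)" "g \<in> carrier (skew_laurent s)"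
    then show "f \<otimes>\<^bsub>skew_laurent s\<^esub> g \<otimes>\<^bsub>skew_laurent s\<^esub> h
        = f \<otimes>\<^bsub>skew_laurent s\<^esub> (g \<otimes>\<^bsub>skew_laurent s\<^esub> h)"
      by (intro sl_assoc) (simp_all add: skew_laurent_def)
  next
    fix f
    show "\<one>\<^bsub>skew_laurent s\<^esub> \<otimes>\<^bsub>skew_laurent s\<^esub> f = f"
      by (rule ext, subst sl_mult_eq[of "{0}"]) (auto simp: skew_laurent_def)
  next
    fix f assume f: "f \<in> carrier (skew_laurent s)"
    show "f \<otimes>\<^bsub>skew_laurent s\<^esub> \<one>\<^bsub>skew_laurent s\<^esub> = f"
    proof
      fix n
      have fin: "finite (insert n {i. f i \<noteq> 0})" using f by (simp add: skew_laurent_def)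
      have "(f \<otimes>\<^bsub>skew_laurent s\<^esub> \<one>\<^bsub>skew_laurent s\<^esub>) n
          = (\<Sum>i\<in>insert n {i. f i \<noteq> 0}. f i * int_iter s i (\<one>\<^bsub>skew_laurent s\<^esub> (n - i)))"
        by (rule sl_mult_eq[OF fin]) auto
      also have "\<dots> = (\<Sum>i\<in>insert n {i. f i \<noteq> 0}. if i = n then f n else 0)"
        by (intro sum.cong[OF refl]) (auto simp: skew_laurent_def)
      also have "\<dots> = f n"
        using fin by (subst sum.delta) auto
      finally show "(f \<otimes>\<^bsub>skew_laurent s\<^esub> \<one>\<^bsub>skew_laurent s\<^esub>) n = f n" .
    qed
  qed
  fix f g h
  assume "f \<in> carrier (skew_laurent s)" "g \<in> carrier (skew_laurent s)"
    "h \<in> carrier (skew_laurent s)"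
  then have fin: "finite {i. f i \<noteq> 0}" "finite {i. g i \<noteq> 0}"
    by (simp_all add: skew_laurent_def)
  let ?U = "{i. f i \<noteq> 0} \<union> {i. g i \<noteq> 0}"
  have U: "finite ?U" using fin by simp
  show "(f \<oplus>\<^bsub>skew_laurent s\<^esub> g) \<otimes>\<^bsub>skew_laurent s\<^esub> h
      = f \<otimes>\<^bsub>skew_laurent s\<^esub> h \<oplus>\<^bsub>skew_laurent s\<^esub> g \<otimes>\<^bsub>skew_laurent s\<^esub> h"
  proof
    fix n
    have add: "(p \<oplus>\<^bsub>skew_laurent s\<^esub> q) k = p k + q k" for p q k
      by (simp add: skew_laurent_def)
    have sub: "{i. (f \<oplus>\<^bsub>skew_laurent s\<^esub> g) i \<noteq> 0} \<subseteq> ?U" by (auto simp: add)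
    have 1: "((f \<oplus>\<^bsub>skew_laurent s\<^esub> g) \<otimes>\<^bsub>skew_laurent s\<^esub> h) n
        = (\<Sum>i\<in>?U. (f \<oplus>\<^bsub>skew_laurent s\<^esub> g) i * int_iter s i (h (n - i)))"
      by (rule sl_mult_eq[OF U sub])
    have 2: "(f \<otimes>\<^bsub>skew_laurent s\<^esub> h) n = (\<Sum>i\<in>?U. f i * int_iter s i (h (n - i)))"
      by (rule sl_mult_eq[OF U]) blast
    have 3: "(g \<otimes>\<^bsub>skew_laurent s\<^esub> h) n = (\<Sum>i\<in>?U. g i * int_iter s i (h (n - i)))"
      by (rule sl_mult_eq[OF U]) blast
    show "((f \<oplus>\<^bsub>skew_laurent s\<^esub> g) \<otimes>\<^bsub>skew_laurent s\<^esub> h) n = (f \<otimes>\<^bsub>skew_laurent s\<^esub> h \<oplus>\<^bsub>skew_laurent s\<^esub> g \<otimes>\<^bsub>skew_laurent s\<^esub> h) n"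
      unfolding 1 add 2 3 distrib_right sum.distrib ..
  qed
  show "h \<otimes>\<^bsub>skew_laurent s\<^esub> (f \<oplus>\<^bsub>skew_laurent s\<^esub> g)
      = h \<otimes>\<^bsub>skew_laurent s\<^esub> f \<oplus>\<^bsub>skew_laurent s\<^esub> h \<otimes>\<^bsub>skew_laurent s\<^esub> g"
    by (simp add: skew_laurent_def iter_plus distrib_left sum.distrib)
qed

lemma sl_var_const:
  "sl_var \<otimes>\<^bsub>skew_laurent s\<^esub> sl_const a = sl_const (s a) \<otimes>\<^bsub>skew_laurent s\<^esub> sl_var"
proof
  fix n
  have "(sl_var \<otimes>\<^bsub>skew_laurent s\<^esub> sl_const a) n = s (if n - 1 = 0 then a else 0)"
    by (subst sl_mult_eq[of "{1}"]) (auto simp: sl_var_def sl_const_def)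
  moreover have "(sl_const (s a) \<otimes>\<^bsub>skew_laurent s\<^esub> sl_var) n = s a * (if n = 1 then 1 else 0)"
    by (subst sl_mult_eq[of "{0}"]) (auto simp: sl_var_def sl_const_def)
  ultimately show "(sl_var \<otimes>\<^bsub>skew_laurent s\<^esub> sl_const a) n
      = (sl_const (s a) \<otimes>\<^bsub>skew_laurent s\<^esub> sl_var) n"
    by (simp add: s_0)
qed

end


section \<open>The skew Laurent polynomial algebra over \<open>\<complex>(h)\<close>\<close>

type_synonym ratfun = "complex poly fract"

definition rf_const :: "complex \<Rightarrow> ratfun" where
  "rf_const c = to_fract [:c:]"

definition rf_h :: ratfun where
  "rf_h = to_fract [:0, 1:]"

text \<open>Substitution of \<open>h - 2\<close> for \<open>h\<close> in numerator and denominator.\<close>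

definition sigma :: "ratfun \<Rightarrow> ratfun" where
  "sigma q = (case quot_of_fract q of
     (a, b) \<Rightarrow> Fract (pcompose a [:- 2, 1:]) (pcompose b [:- 2, 1:]))"

lemma sigma_Fract:
  assumes "b \<noteq> 0"
  shows "sigma (Fract a b) = Fract (pcompose a [:- 2, 1:]) (pcompose b [:- 2, 1:])"
proof -
  obtain c d where cd: "quot_of_fract (Fract a b) = (c, d)" by (cases "quot_of_fract (Fract a b)")
  then have d: "d \<noteq> 0" using snd_quot_of_fract_nonzero[of "Fract a b"] by simp
  have "Fract c d = Fract a b"
    using quot_to_fract_quot_of_fract[of "Fract a b"] cd by (simp add: quot_to_fract_def)
  then have "c * b = a * d" using assms d by (simp add: eq_fract)
  then have "pcompose c [:- 2, 1:] * pcompose b [:- 2, 1:]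
      = pcompose a [:- 2, 1:] * pcompose d [:- 2, 1:]"
    by (metis pcompose_mult)
  then show ?thesis
    using assms d cd by (simp add: sigma_def eq_fract pcompose_eq_0_iff)
qed

lemma sigma_h: "sigma rf_h = rf_h - rf_const 2"
  by (simp add: rf_h_def rf_const_def to_fract_def sigma_Fract pcompose_pCons pcompose_1)

lemma sigma_const: "sigma (rf_const c) = rf_const c"
  by (simp add: rf_const_def to_fract_def sigma_Fract pcompose_1)

interpretation sigma: field_aut sigma
proof
  have nz: "pcompose p [:c, 1:] \<noteq> 0" if "p \<noteq> 0" for p :: "complex poly" and c
    using that by (simp add: pcompose_eq_0_iff)
  have inv1: "pcompose (pcompose p [:2, 1:]) [:- 2, 1:] = p" for p :: "complex poly"
    by (simp add: pcompose_pCons flip: pcompose_assoc)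
  show "bij sigma"
  proof (rule bijI)
    show "surj sigma"
    proof (rule surjI)
      fix q :: ratfun
      have "\<exists>r. sigma r = q"
      proof (cases q)
        case (Fract a b)
        then have "sigma (Fract (pcompose a [:2, 1:]) (pcompose b [:2, 1:])) = q"
          by (simp add: sigma_Fract nz inv1)
        then show ?thesis by blast
      qed
      then show "sigma ((\<lambda>q. SOME r. sigma r = q) q) = q" by (rule someI_ex)
    qed
    show "inj sigma"
    proof (rule injI)
      fix p q assume eq: "sigma p = sigma q"
      obtain a b where p: "p = Fract a b" "b \<noteq> 0" by (cases p)
      obtain c d where q: "q = Fract c d" "d \<noteq> 0" by (cases q)
      have "Fract (pcompose a [:- 2, 1:]) (pcompose b [:- 2, 1:])
          = Fract (pcompose c [:- 2, 1:]) (pcompose d [:- 2, 1:])"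
        using eq unfolding p(1) q(1) sigma_Fract[OF p(2)] sigma_Fract[OF q(2)] .
      then have "pcompose a [:- 2, 1:] * pcompose d [:- 2, 1:]
          = pcompose c [:- 2, 1:] * pcompose b [:- 2, 1:]"
        unfolding eq_fract(1)[OF nz[OF p(2)] nz[OF q(2)]] .
      then have "pcompose (a * d - c * b) [:- 2, 1:] = 0"
        unfolding pcompose_diff pcompose_mult by (rule right_minus_eq[THEN iffD2])
      then have "a * d - c * b = 0" using nz by blast
      then show "p = q" using p q by (simp add: eq_fract)
    qed
  qed
  fix p q :: ratfun
  obtain a b where p: "p = Fract a b" "b \<noteq> 0" by (cases p)
  obtain c d where q: "q = Fract c d" "d \<noteq> 0" by (cases q)
  have bd: "b * d \<noteq> 0" using p q by simp
  show "sigma (p + q) = sigma p + sigma q"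
    unfolding p(1) q(1) add_fract[OF p(2) q(2)] sigma_Fract[OF p(2)] sigma_Fract[OF q(2)]
      sigma_Fract[OF bd] add_fract[OF nz[OF p(2)] nz[OF q(2)]] pcompose_add pcompose_mult ..
  show "sigma (p * q) = sigma p * sigma q"
    unfolding p(1) q(1) mult_fract sigma_Fract[OF p(2)] sigma_Fract[OF q(2)]
      sigma_Fract[OF bd] pcompose_mult ..
qed

abbreviation R_alg :: "(int \<Rightarrow> ratfun) ring" where
  "R_alg \<equiv> skew_laurent sigma"

definition binom :: "nat \<Rightarrow> ratfun \<Rightarrow> int \<Rightarrow> ratfun" where
  "binom m b = sl_var [^]\<^bsub>R_alg\<^esub> m \<ominus>\<^bsub>R_alg\<^esub> sl_const b"


section \<open>The parameters and the action of the cyclic group\<close>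

definition Omega :: "real \<Rightarrow> complex set" where
  "Omega \<omega> = {z. \<omega> \<le> Re z \<and> Re z < \<omega> + 2}"

text \<open>A tuple \<open>(c, \<zeta>\<^sub>0, \<dots>, \<zeta>\<^sub>m\<^sub>-\<^sub>1)\<close> is a pair of \<open>c\<close> and a list of length \<open>m\<close>. Functions on
  \<open>Omega \<omega>\<close> are represented by their extensions by zero to \<open>\<complex>\<close>.\<close>

type_synonym param = "complex \<times> (complex \<Rightarrow> int) list"

definition Psi :: "real \<Rightarrow> nat \<Rightarrow> param set" where
  "Psi \<omega> m = {(c, zs). c \<noteq> 0 \<and> length zs = m \<and>
     (\<forall>z\<in>set zs. {l. z l \<noteq> 0} \<subseteq> Omega \<omega> \<and> finite {l. z l \<noteq> 0})}"

definition g_param :: "real \<Rightarrow> param \<Rightarrow> ratfun" where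
  "g_param \<omega> = (\<lambda>(c, zs). rf_const c *
     (\<Prod>i<length zs. \<Prod>l | l \<in> Omega \<omega> \<and> (zs ! i) l \<noteq> 0.
        (rf_h - rf_const l - rf_const (2 * of_nat i)) powi (zs ! i) l))"

text \<open>By \<open>nth_rotate\<close>, the \<open>i\<close>-th entry of \<open>rotate k zs\<close> is entry \<open>(i + k) mod m\<close> of \<open>zs\<close>. The group
  \<open>integer_mod_group m\<close> has carrier \<open>{0..<m}\<close> for positive \<open>m\<close>, so \<open>nat\<close> does not truncate.\<close>

definition psi_act :: "real \<Rightarrow> nat \<Rightarrow> int \<Rightarrow> param \<Rightarrow> param" where
  "psi_act \<omega> m k = (\<lambda>(c, zs)\<in>Psi \<omega> m. (c, rotate (nat k) zs))"

lemma group_action_psi_act: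
  assumes m: "m > 0"
  shows "group_action (integer_mod_group m) (Psi \<omega> m) (psi_act \<omega> m)"
proof -
  have closed: "psi_act \<omega> m k p \<in> Psi \<omega> m" if "p \<in> Psi \<omega> m" for k p
    using that by (auto simp: psi_act_def Psi_def)
  have comp: "psi_act \<omega> m ((j + k) mod int m) p = psi_act \<omega> m j (psi_act \<omega> m k p)"
    if p: "p \<in> Psi \<omega> m" and "0 \<le> j" "0 \<le> k" for j k p
  proof -
    obtain c zs where [simp]: "p = (c, zs)" by (cases p)
    have len: "length zs = m" using p by (simp add: Psi_def)
    have "nat ((j + k) mod int m) = (nat j + nat k) mod length zs"
      using that m len by (simp add: nat_mod_distrib nat_add_distrib)
    then have "rotate (nat ((j + k) mod int m)) zs = rotate (nat j) (rotate (nat k) zs)"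
      by (simp add: rotate_rotate rotate_conv_mod[of "nat j + nat k"])
    then show ?thesis
      using p closed[OF p, of k] by (simp add: psi_act_def)
  qed
  have zero: "psi_act \<omega> m 0 p = p" if "p \<in> Psi \<omega> m" for p
    using that by (cases p) (simp add: psi_act_def)
  have bij: "psi_act \<omega> m k \<in> Bij (Psi \<omega> m)" if k: "0 \<le> k" "k < int m" for k
  proof -
    have "(k + (int m - k)) mod int m = 0" "((int m - k) + k) mod int m = 0" by simp_all
    then have "psi_act \<omega> m k (psi_act \<omega> m (int m - k) p) = p"
      "psi_act \<omega> m (int m - k) (psi_act \<omega> m k p) = p" if "p \<in> Psi \<omega> m" for p
      using comp[OF that, of k "int m - k"] comp[OF that, of "int m - k" k] zero[OF that] k
      by simp_all
    then have "bij_betw (psi_act \<omega> m k) (Psi \<omega> m) (Psi \<omega> m)"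
      by (intro bij_betwI[where g = "psi_act \<omega> m (int m - k)"]) (auto simp: closed)
    then show ?thesis by (simp add: Bij_def psi_act_def)
  qed
  have carr: "carrier (integer_mod_group m) = {0..<int m}"
    using m by (simp add: carrier_integer_mod_group)
  show ?thesis
  proof (intro group_action.intro group_hom.intro group_hom_axioms.intro)
    show "psi_act \<omega> m \<in> hom (integer_mod_group m) (BijGroup (Psi \<omega> m))"
    proof (rule homI)
      fix j k assume "j \<in> carrier (integer_mod_group m)" "k \<in> carrier (integer_mod_group m)"
      then have jk: "0 \<le> j" "j < int m" "0 \<le> k" "k < int m" by (auto simp: carr)
      have "psi_act \<omega> m ((j + k) mod int m)
          = compose (Psi \<omega> m) (psi_act \<omega> m j) (psi_act \<omega> m k)"
      proof (rule extensionalityI)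
        show "psi_act \<omega> m ((j + k) mod int m) \<in> extensional (Psi \<omega> m)"
          by (simp add: psi_act_def)
        show "compose (Psi \<omega> m) (psi_act \<omega> m j) (psi_act \<omega> m k) \<in> extensional (Psi \<omega> m)"
          by simp
      qed (simp add: compose_def comp jk)
      then show "psi_act \<omega> m (j \<otimes>\<^bsub>integer_mod_group m\<^esub> k)
          = psi_act \<omega> m j \<otimes>\<^bsub>BijGroup (Psi \<omega> m)\<^esub> psi_act \<omega> m k"
        using bij jk by (simp add: BijGroup_def)
    qed (auto simp: carr BijGroup_def bij)
  qed (simp_all add: group_BijGroup)
qed

definition psi_orbit :: "real \<Rightarrow> nat \<Rightarrow> param \<Rightarrow> param set" where
  "psi_orbit \<omega> m p = orbit (integer_mod_group m) (psi_act \<omega> m) p"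

definition psi_regular :: "real \<Rightarrow> nat \<Rightarrow> param \<Rightarrow> bool" where
  "psi_regular \<omega> m p \<longleftrightarrow> card (psi_orbit \<omega> m p) = m"

end

theory Submission
  imports Defs
begin

text \<open>As a module over the subring generated by \<open>\<complex>(h)\<close> and \<open>x\<^sup>m\<close>, the quotient of \<open>R\<close> by
  \<open>R(x\<^sup>m - g)\<close> is the direct sum of the lines spanned by \<open>1, x, \<dots>, x\<^sup>m\<^sup>-\<^sup>1\<close>, and \<open>x\<^sup>m\<close> acts on the
  \<open>k\<close>-th line through \<open>\<sigma>\<^sup>k(g)\<close>. Two such lines are isomorphic iff the corresponding elements differ
  by a factor \<open>\<sigma>\<^sup>m(v)/v\<close>. Modulo these factors, a nonzero rational function is determined by its
  leading coefficient and by its divisor with exponents summed along the classes of \<open>\<complex>\<close> modulo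
  \<open>2m\<close>, so that the tuples \<open>\<zeta>\<close> represent each class exactly once and \<open>\<sigma>\<close> acts by rotation. If the
  orbit of \<open>\<zeta>\<close> is regular, the lines are pairwise non-isomorphic and are permuted cyclically by
  \<open>x\<close>, hence the module is simple; if \<open>\<zeta>\<close> is periodic with period \<open>d < m\<close>, then \<open>x\<^sup>m - g\<close> has a
  right factor \<open>x\<^sup>d - c\<close>.\<close>

section \<open>Principal left ideals\<close>

context ring begin

lemma left_principalI: "r \<in> carrier R \<Longrightarrow> r \<otimes> a \<in> left_principal R a"
  by (auto simp: left_principal_def)

lemma left_ideal_left_principal:
  assumes a: "a \<in> carrier R"
  shows "left_ideal (left_principal R a) R"
proof -
  have "additive_subgroup (left_principal R a) R"
  proof (intro additive_subgroup.intro subgroup.intro, simp_all)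
    show "left_principal R a \<subseteq> carrier R"
      using a by (auto simp: left_principal_def)
    show "\<zero> \<in> left_principal R a"
      using left_principalI[OF zero_closed, of a] a by simp
    fix x assume "x \<in> left_principal R a"
    then obtain r where r: "r \<in> carrier R" "x = r \<otimes> a"
      by (auto simp: left_principal_def)
    have "inv\<^bsub>add_monoid R\<^esub> x = (\<ominus> r) \<otimes> a"
      using r a by (simp add: a_inv_def[symmetric] l_minus)
    then show "inv\<^bsub>add_monoid R\<^esub> x \<in> left_principal R a"
      using r a_inv_closed unfolding left_principal_def by blast
    fix y assume "y \<in> left_principal R a"
    then obtain t where t: "t \<in> carrier R" "y = t \<otimes> a"
      by (auto simp: left_principal_def)
    have "x \<oplus> y = (r \<oplus> t) \<otimes> a"
      using r t a by (simp add: l_distr)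
    then show "x \<oplus> y \<in> left_principal R a"
      using r t a_closed unfolding left_principal_def by blast
  qed
  moreover have "r \<otimes> x \<in> left_principal R a"
    if "x \<in> left_principal R a" "r \<in> carrier R" for x r
  proof -
    obtain t where "t \<in> carrier R" "x = t \<otimes> a"
      using \<open>x \<in> _\<close> by (auto simp: left_principal_def)
    then show ?thesis
      using left_principalI[of "r \<otimes> t" a] a \<open>r \<in> carrier R\<close> by (simp add: m_assoc)
  qed
  ultimately show ?thesis
    by (intro left_ideal.intro left_ideal_axioms.intro) (auto intro: ring_axioms)
qed

lemma left_principal_self:
  assumes "a \<in> carrier R" shows "a \<in> left_principal R a"
  using left_principalI[OF one_closed, of a] assms by simp

text \<open>The set is \<open>R a + I\<close>, the smallest left ideal containing \<open>a\<close>
  and \<open>I\<close>; it is the ideal against which maximality of \<open>I\<close> is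
  tested.\<close>

lemma left_ideal_sum_left_principal:
  assumes I: "left_ideal I R" and a: "a \<in> carrier R"
  shows "left_ideal {r \<otimes> a \<oplus> i | r i. r \<in> carrier R \<and> i \<in> I} R" (is "left_ideal ?J R")
proof -
  interpret I: left_ideal I R by (rule I)
  have car: "i \<in> carrier R" if "i \<in> I" for i using that I.a_subset by blast
  have neg: "\<ominus> i \<in> I" if "i \<in> I" for i using that by (rule I.a_inv_closed)
  have mem: "r \<otimes> a \<oplus> i \<in> ?J" if "r \<in> carrier R" "i \<in> I" for r i
    using that by blast
  have "additive_subgroup ?J R"
  proof (intro additive_subgroup.intro subgroup.intro, simp_all only: partial_object.simps monoid.simps)
    show "?J \<subseteq> carrier R" using a car by auto
    show "\<zero> \<in> ?J" using mem[of \<zero> \<zero>] a by simp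
    fix x assume "x \<in> ?J"
    then obtain r i where x: "x = r \<otimes> a \<oplus> i" "r \<in> carrier R" "i \<in> I" by blast
    have "\<ominus> x = (\<ominus> r) \<otimes> a \<oplus> (\<ominus> i)"
      using x a car by (simp add: l_minus minus_add)
    then show "inv\<^bsub>add_monoid R\<^esub> x \<in> ?J"
      using mem[of "\<ominus> r" "\<ominus> i"] x neg by (simp add: a_inv_def[symmetric])
    fix y assume "y \<in> ?J"
    then obtain t j where y: "y = t \<otimes> a \<oplus> j" "t \<in> carrier R" "j \<in> I" by blast
    have "x \<oplus> y = (r \<oplus> t) \<otimes> a \<oplus> (i \<oplus> j)"
      using x y a car by (simp add: l_distr a_ac)
    then show "x \<oplus> y \<in> ?J"
      using mem[of "r \<oplus> t" "i \<oplus> j"] x y by simp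
  qed
  moreover have "t \<otimes> x \<in> ?J" if "x \<in> ?J" "t \<in> carrier R" for x t
  proof -
    obtain r i where x: "x = r \<otimes> a \<oplus> i" "r \<in> carrier R" "i \<in> I" using \<open>x \<in> ?J\<close> by blast
    have "t \<otimes> x = (t \<otimes> r) \<otimes> a \<oplus> t \<otimes> i"
      using x a car that by (simp add: r_distr m_assoc)
    then show ?thesis
      using mem[of "t \<otimes> r" "t \<otimes> i"] x that I.I_l_closed by simp
  qed
  ultimately show ?thesis
    by (intro left_ideal.intro left_ideal_axioms.intro) (auto intro: ring_axioms)
qed

lemma left_ideal_eq_carrier:
  assumes "left_ideal J R" "\<one> \<in> J" shows "J = carrier R"
proof -
  interpret J: left_ideal J R by fact
  have "x \<in> J" if "x \<in> carrier R" for x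
    using J.I_l_closed[OF assms(2) that] that by simp
  then show ?thesis using J.a_subset by blast
qed

text \<open>If \<open>f\<close> lies outside \<open>I\<close>, then \<open>R f + I\<close> is
  strictly larger than \<open>I\<close>, and a left ideal is everything once it contains 1. This
  replaces the quantification over ideals by identities between elements.\<close>

lemma maximal_left_ideal_iff:
  assumes I: "left_ideal I R"
  shows "maximal_left_ideal I R \<longleftrightarrow>
    \<one> \<notin> I \<and> (\<forall>f\<in>carrier R - I. \<exists>r\<in>carrier R. \<exists>i\<in>I. r \<otimes> f \<oplus> i = \<one>)"
proof
  interpret I: left_ideal I R by (rule I)
  assume "maximal_left_ideal I R"
  then interpret M: maximal_left_ideal I R .
  have "\<exists>r\<in>carrier R. \<exists>i\<in>I. r \<otimes> f \<oplus> i = \<one>" if f: "f \<in> carrier R" "f \<notin> I" for f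
  proof -
    let ?J = "{r \<otimes> f \<oplus> i | r i. r \<in> carrier R \<and> i \<in> I}"
    have car: "i \<in> carrier R" if "i \<in> I" for i using that I.a_subset by blast
    have "i = \<zero> \<otimes> f \<oplus> i" if "i \<in> I" for i using that f car by simp
    then have "I \<subseteq> ?J" by blast
    moreover have "\<one> \<otimes> f \<oplus> \<zero> \<in> ?J" using I.zero_closed one_closed by blast
    then have "f \<in> ?J" unfolding l_one[OF f(1)] r_zero[OF f(1)] .
    ultimately have "?J = carrier R"
      using M.I_maximal[OF left_ideal_sum_left_principal[OF I f(1)]] f(2) by blast
    then have "\<one> \<in> ?J" by simp
    then obtain r i where "\<one> = r \<otimes> f \<oplus> i" "r \<in> carrier R" "i \<in> I" by blast
    then show ?thesis by metis
  qed
  moreover have "\<one> \<notin> I" using left_ideal_eq_carrier[OF I] M.I_notcarr by auto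
  ultimately show "\<one> \<notin> I \<and> (\<forall>f\<in>carrier R - I. \<exists>r\<in>carrier R. \<exists>i\<in>I. r \<otimes> f \<oplus> i = \<one>)"
    by blast
next
  assume H: "\<one> \<notin> I \<and> (\<forall>f\<in>carrier R - I. \<exists>r\<in>carrier R. \<exists>i\<in>I. r \<otimes> f \<oplus> i = \<one>)"
  show "maximal_left_ideal I R"
  proof (intro maximal_left_ideal.intro maximal_left_ideal_axioms.intro I)
    show "carrier R \<noteq> I" using H by auto
    fix J assume J: "left_ideal J R" "I \<subseteq> J"
    interpret J: left_ideal J R by (rule J)
    show "J = I \<or> J = carrier R"
    proof (cases "J \<subseteq> I")
      case False
      then obtain f where f: "f \<in> J" "f \<notin> I" by blast
      then obtain r i where ri: "r \<in> carrier R" "i \<in> I" "r \<otimes> f \<oplus> i = \<one>"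
        using H J.a_subset by blast
      have "r \<otimes> f \<oplus> i \<in> J"
        using ri J f by (intro J.a_closed J.I_l_closed) auto
      then show ?thesis using ri left_ideal_eq_carrier[OF J(1)] by simp
    qed (use J in blast)
  qed
qed

lemma left_irreducible_iff:
  assumes a: "a \<in> carrier R"
  shows "left_irreducible R a \<longleftrightarrow> a \<noteq> \<zero> \<and> maximal_left_ideal (left_principal R a) R"
proof -
  have "a \<notin> Units R" if "maximal_left_ideal (left_principal R a) R"
  proof
    assume "a \<in> Units R"
    then have "\<one> \<in> left_principal R a"
      using Units_l_inv_ex[of a] by (force simp: left_principal_def)
    with that show False
      using maximal_left_ideal_iff[OF left_ideal_left_principal[OF a]] by blast
  qed
  then show ?thesis using a by (auto simp: left_irreducible_def)
qed

text \<open>Right multiplication by \<open>v\<close> maps \<open>R a\<close> into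
  \<open>R b\<close>, because \<open>a v = w b\<close>, and right multiplication by
  \<open>inv v\<close> maps back; so the elementwise criterion for maximality transfers.\<close>

lemma left_irreducible_associated:
  assumes irr: "left_irreducible R a" and b: "b \<in> carrier R"
    and v: "v \<in> Units R" and w: "w \<in> Units R" and eq: "a \<otimes> v = w \<otimes> b"
  shows "left_irreducible R b"
proof -
  have a: "a \<in> carrier R" and a0: "a \<noteq> \<zero>" using irr by (auto simp: left_irreducible_def)
  note c = a b Units_closed[OF v] Units_closed[OF w] Units_inv_closed[OF v] Units_inv_closed[OF w]
  have b_eq: "b = inv w \<otimes> a \<otimes> v"
    using c eq w by (metis Units_l_inv l_one m_assoc)
  have a_eq: "a = w \<otimes> b \<otimes> inv v"
    using c eq v by (metis Units_r_inv r_one m_assoc)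
  have "b \<noteq> \<zero>" using a_eq a0 c by auto
  note Ia = left_ideal_left_principal[OF a] and Ib = left_ideal_left_principal[OF b]
  have M: "\<one> \<notin> left_principal R a"
    "\<And>f. f \<in> carrier R \<Longrightarrow> f \<notin> left_principal R a \<Longrightarrow>
       \<exists>r\<in>carrier R. \<exists>i\<in>left_principal R a. r \<otimes> f \<oplus> i = \<one>"
    using irr maximal_left_ideal_iff[OF Ia] by (auto simp: left_irreducible_def)
  have trans_ab: "f \<otimes> v \<in> left_principal R b" if f: "f \<in> left_principal R a" for f
  proof -
    obtain r where "r \<in> carrier R" "f = r \<otimes> a" using f by (auto simp: left_principal_def)
    then have "f \<otimes> v = (r \<otimes> w) \<otimes> b" "r \<otimes> w \<in> carrier R" using c eq by (simp_all add: m_assoc)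
    then show ?thesis unfolding left_principal_def by blast
  qed
  have trans_ba: "f \<otimes> inv v \<in> left_principal R a" if f: "f \<in> left_principal R b" for f
  proof -
    obtain r where r: "r \<in> carrier R" "f = r \<otimes> b" using f by (auto simp: left_principal_def)
    then have "f \<otimes> inv v = (r \<otimes> inv w) \<otimes> a \<otimes> (v \<otimes> inv v)"
      using c b_eq by (simp add: m_assoc)
    then have "f \<otimes> inv v = (r \<otimes> inv w) \<otimes> a" "r \<otimes> inv w \<in> carrier R"
      using c v r by simp_all
    then show ?thesis unfolding left_principal_def by blast
  qed
  interpret Ia: left_ideal "left_principal R a" R by (rule Ia)
  interpret Ib: left_ideal "left_principal R b" R by (rule Ib)
  have "\<one> \<notin> left_principal R b"
  proof
    assume "\<one> \<in> left_principal R b"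
    then have "v \<otimes> (\<one> \<otimes> inv v) \<in> left_principal R a"
      using trans_ba Ia.I_l_closed c by blast
    then show False using M(1) c v by simp
  qed
  moreover have "\<exists>r\<in>carrier R. \<exists>i\<in>left_principal R b. r \<otimes> f \<oplus> i = \<one>"
    if f: "f \<in> carrier R - left_principal R b" for f
  proof -
    have "f \<otimes> inv v \<notin> left_principal R a"
    proof
      assume "f \<otimes> inv v \<in> left_principal R a"
      from trans_ab[OF this] show False using f c v by (simp add: m_assoc)
    qed
    then obtain r i where ri: "r \<in> carrier R" "i \<in> left_principal R a" "r \<otimes> (f \<otimes> inv v) \<oplus> i = \<one>"
      using M(2)[of "f \<otimes> inv v"] f c by auto
    have i: "i \<in> carrier R" using ri Ia.a_subset by blast
    \<comment> \<open>Conjugation by \<open>v\<close> fixes 1 and turns the identity for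
      \<open>f v^-1\<close> into one for \<open>f\<close>.\<close>
    have "inv v \<otimes> (r \<otimes> (f \<otimes> inv v) \<oplus> i) \<otimes> v = \<one>" using ri c v by simp
    then have "inv v \<otimes> (r \<otimes> (f \<otimes> (inv v \<otimes> v))) \<oplus> inv v \<otimes> (i \<otimes> v) = \<one>"
      using ri(1) c i f by (simp add: r_distr l_distr m_assoc)
    then have "inv v \<otimes> r \<otimes> f \<oplus> inv v \<otimes> (i \<otimes> v) = \<one>"
      using ri(1) c v f by (simp add: m_assoc)
    moreover have "inv v \<otimes> (i \<otimes> v) \<in> left_principal R b"
      using trans_ab[OF ri(2)] Ib.I_l_closed c by blast
    ultimately show ?thesis using ri(1) c by blast
  qed
  ultimately have "maximal_left_ideal (left_principal R b) R"
    using maximal_left_ideal_iff[OF Ib] by blast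
  then show ?thesis using left_irreducible_iff[OF b] \<open>b \<noteq> \<zero>\<close> by blast
qed

end

section \<open>Cosets of a left ideal and isomorphisms of cyclic modules\<close>

context left_ideal begin

lemma coset_eq_iff:
  assumes "x \<in> carrier R" "y \<in> carrier R"
  shows "I +> x = I +> y \<longleftrightarrow> x \<ominus> y \<in> I"
proof -
  interpret S: abelian_subgroup I R
    by (rule abelian_subgroupI3) (unfold_locales)
  show ?thesis
    using S.a_rcos_module_minus[OF ring_axioms assms(2,1)] S.a_repr_independence'[of x y]
      S.a_repr_independenceD[OF assms(1), of y] assms by auto
qed

lemma coset_eq_self_iff:
  assumes "x \<in> carrier R"
  shows "I +> x = I \<longleftrightarrow> x \<in> I"
  using coset_eq_iff[OF assms zero_closed] a_subset assms by (simp add: a_minus_def)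

lemma carrier_left_quotient: "carrier (left_quotient R I) = (\<lambda>x. I +> x) ` carrier R"
  by (auto simp: left_quotient_def A_RCOSETS_def')

end

text \<open>A homomorphism from \<open>R/Ra\<close> to \<open>R/J\<close> is determined by the image
  \<open>J + v\<close> of the coset of 1, subject to \<open>a v\<close> lying in \<open>J\<close>,
  and is nonzero when \<open>v\<close> is outside \<open>J\<close>. Between simple modules a nonzero
  homomorphism is bijective, as in Schur's lemma.\<close>

lemma (in ring) left_module_iso_quotient_iff:
  assumes I: "maximal_left_ideal (left_principal R a) R" and J: "maximal_left_ideal J R"
    and a: "a \<in> carrier R"
  shows "left_module_iso R (left_quotient R (left_principal R a)) (left_quotient R J) \<longleftrightarrow>
    (\<exists>v\<in>carrier R. v \<notin> J \<and> a \<otimes> v \<in> J)"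
proof -
  define I where "I = left_principal R a"
  interpret I: maximal_left_ideal I R using I by (simp add: I_def)
  interpret J: maximal_left_ideal J R by (rule J)
  let ?M = "left_quotient R I" and ?N = "left_quotient R J"
  have aI: "a \<in> I" using a by (simp add: I_def left_principal_self)
  have one_I: "\<one> \<notin> I" using left_ideal_eq_carrier I.I_notcarr I.left_ideal_axioms by blast
  have "\<exists>v\<in>carrier R. v \<notin> J \<and> a \<otimes> v \<in> J"
    if iso: "left_module_iso R ?M ?N"
  proof -
    obtain f where bij: "bij_betw f (carrier ?M) (carrier ?N)"
      and lin: "\<And>r u. r \<in> carrier R \<Longrightarrow> u \<in> carrier ?M \<Longrightarrow>
        f (r \<odot>\<^bsub>?M\<^esub> u) = r \<odot>\<^bsub>?N\<^esub> f u"
      using iso unfolding left_module_iso_def by blast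
    have "f (I +> \<one>) \<in> carrier ?N"
      using bij_betwE[OF bij] I.carrier_left_quotient one_closed by blast
    then obtain v where v: "v \<in> carrier R" "f (I +> \<one>) = J +> v"
      using J.carrier_left_quotient by auto
    have f: "f (I +> r) = J +> (r \<otimes> v)" if r: "r \<in> carrier R" for r
    proof -
      have "f (r \<odot>\<^bsub>?M\<^esub> (I +> \<one>)) = r \<odot>\<^bsub>?N\<^esub> (J +> v)"
        using lin[OF r, of "I +> \<one>"] v(2) I.carrier_left_quotient by auto
      then show ?thesis
        using I.left_quotient_smult[OF r one_closed] J.left_quotient_smult[OF r v(1)] r by simp
    qed
    have inj: "I +> r = I +> t"
      if "r \<in> carrier R" "t \<in> carrier R" "f (I +> r) = f (I +> t)" for r t
      using that bij by (auto simp: bij_betw_def inj_on_def I.carrier_left_quotient)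
    have f0: "f (I +> \<zero>) = J" using f[of \<zero>] v J.a_subset by simp
    have I0: "I +> \<zero> = I" using I.a_subset by simp
    have "I +> a = I" using aI a I.coset_eq_self_iff by blast
    then have "J +> (a \<otimes> v) = J" using f[OF a] f0 I0 by simp
    then have "a \<otimes> v \<in> J" using J.coset_eq_self_iff a v by simp
    moreover have "v \<notin> J"
    proof
      assume "v \<in> J"
      then have "f (I +> \<one>) = f (I +> \<zero>)" using v f0 J.coset_eq_self_iff by simp
      from inj[OF one_closed zero_closed this] have "I +> \<one> = I" using I0 by simp
      then show False using one_I I.coset_eq_self_iff by simp
    qed
    ultimately show ?thesis using v by blast
  qed
  moreover have "left_module_iso R ?M ?N"
    if v: "v \<in> carrier R" and vJ: "v \<notin> J" and av: "a \<otimes> v \<in> J" for v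
  proof -
    have ker: "r \<otimes> v \<in> J" if r: "r \<in> I" for r
    proof -
      obtain t where t: "t \<in> carrier R" "r = t \<otimes> a"
        using r unfolding I_def left_principal_def by blast
      show ?thesis
        unfolding t(2) m_assoc[OF t(1) a v] using av t(1) by (rule J.I_l_closed)
    qed
    \<comment> \<open>The annihilator of the coset of \<open>v\<close> is no larger than
      \<open>I\<close>: otherwise maximality of \<open>I\<close> gives \<open>1 = t r + i\<close>,
      and multiplying by \<open>v\<close> puts \<open>v\<close> into \<open>J\<close>.\<close>
    have ker': "r \<in> I" if r: "r \<in> carrier R" "r \<otimes> v \<in> J" for r
    proof (rule ccontr)
      assume "r \<notin> I"
      then obtain t i where t: "t \<in> carrier R" "i \<in> I" "t \<otimes> r \<oplus> i = \<one>"
        using maximal_left_ideal_iff[OF I.left_ideal_axioms] I.maximal_left_ideal_axioms r by blast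
      have i: "i \<in> carrier R" using t I.a_subset by blast
      have "t \<otimes> (r \<otimes> v) \<oplus> i \<otimes> v \<in> J"
        using J.I_l_closed[OF r(2) t(1)] ker[OF t(2)] by (rule J.a_closed)
      also have "t \<otimes> (r \<otimes> v) \<oplus> i \<otimes> v = v"
        using t r i v by (simp flip: m_assoc l_distr)
      finally show False using vJ by blast
    qed
    have eq_iff: "J +> (r \<otimes> v) = J +> (t \<otimes> v) \<longleftrightarrow> I +> r = I +> t"
      if "r \<in> carrier R" "t \<in> carrier R" for r t
    proof -
      have "r \<otimes> v \<ominus> t \<otimes> v = (r \<ominus> t) \<otimes> v" using that v by (simp add: a_minus_def l_distr l_minus)
      then show ?thesis
        using that v ker ker'[of "r \<ominus> t"] by (auto simp: J.coset_eq_iff I.coset_eq_iff)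
    qed
    \<comment> \<open>The map sends \<open>I + r\<close> to \<open>J + r v\<close>. By
      \<open>eq_iff\<close> the chosen representative does not matter and the map is
      injective.\<close>
    define f where "f X = J +> ((SOME r. r \<in> carrier R \<and> I +> r = X) \<otimes> v)" for X
    have f: "f (I +> r) = J +> (r \<otimes> v)" if r: "r \<in> carrier R" for r
    proof -
      let ?t = "SOME t. t \<in> carrier R \<and> I +> t = I +> r"
      have "?t \<in> carrier R \<and> I +> ?t = I +> r" by (rule someI[of _ r]) (use r in simp)
      then show ?thesis using eq_iff[of ?t r] r by (simp add: f_def)
    qed
    have "bij_betw f (carrier ?M) (carrier ?N)"
      unfolding bij_betw_def
    proof
      show "inj_on f (carrier ?M)"
        by (auto simp: inj_on_def I.carrier_left_quotient f eq_iff)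
      show "f ` carrier ?M = carrier ?N"
      proof
        show "f ` carrier ?M \<subseteq> carrier ?N"
          using v by (auto simp: I.carrier_left_quotient J.carrier_left_quotient f)
        show "carrier ?N \<subseteq> f ` carrier ?M"
        proof
          fix Y assume "Y \<in> carrier ?N"
          then obtain y where y: "y \<in> carrier R" "Y = J +> y"
            by (auto simp: J.carrier_left_quotient)
          \<comment> \<open>Since \<open>v\<close> is outside the maximal ideal \<open>J\<close>, 1
            is congruent to \<open>t v\<close> modulo \<open>J\<close>; hence the coset of
            \<open>y\<close> is the image of the coset of \<open>y t\<close>.\<close>
          obtain t i where t: "t \<in> carrier R" "i \<in> J" "t \<otimes> v \<oplus> i = \<one>"
            using maximal_left_ideal_iff[OF J.left_ideal_axioms] J.maximal_left_ideal_axioms v vJ by blast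
          have i: "i \<in> carrier R" using t J.a_subset by blast
          have "y = y \<otimes> (t \<otimes> v \<oplus> i)" using y t by simp
          also have "\<dots> = y \<otimes> i \<oplus> y \<otimes> t \<otimes> v"
            using y(1) t(1) i v by (simp add: r_distr m_assoc a_comm)
          finally have y_eq: "y = y \<otimes> i \<oplus> y \<otimes> t \<otimes> v" .
          have "y \<ominus> y \<otimes> t \<otimes> v = y \<otimes> i"
            by (subst y_eq) (use y(1) t(1) i v in \<open>simp add: a_minus_def a_assoc r_neg\<close>)
          then have "y \<ominus> y \<otimes> t \<otimes> v \<in> J"
            using y(1) t(2) J.I_l_closed by simp
          then have "Y = f (I +> (y \<otimes> t))"
            using y t v by (simp add: f J.coset_eq_iff)
          then show "Y \<in> f ` carrier ?M" using y t by (auto simp: I.carrier_left_quotient)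
        qed
      qed
    qed
    moreover have "f (X \<oplus>\<^bsub>?M\<^esub> Y) = f X \<oplus>\<^bsub>?N\<^esub> f Y"
      if XY: "X \<in> carrier ?M" "Y \<in> carrier ?M" for X Y
    proof -
      obtain x y where "x \<in> carrier R" "X = I +> x" "y \<in> carrier R" "Y = I +> y"
        using XY unfolding I.carrier_left_quotient by blast
      then show ?thesis
        using f[of x] f[of y] f[of "x \<oplus> y"] v
        by (simp add: I.left_quotient_add J.left_quotient_add l_distr)
    qed
    moreover have "f (r \<odot>\<^bsub>?M\<^esub> X) = r \<odot>\<^bsub>?N\<^esub> f X"
      if r: "r \<in> carrier R" and X: "X \<in> carrier ?M" for r X
    proof -
      obtain x where "x \<in> carrier R" "X = I +> x"
        using X unfolding I.carrier_left_quotient by blast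
      then show ?thesis
        using f[of x] f[of "r \<otimes> x"] r v
        by (simp add: I.left_quotient_smult J.left_quotient_smult m_assoc)
    qed
    ultimately show ?thesis
      unfolding left_module_iso_def by (intro exI[of _ f] conjI ballI)
  qed
  ultimately show ?thesis unfolding I_def[symmetric] by blast
qed


section \<open>Binomials in skew Laurent polynomial rings\<close>

definition sl_monom :: "'a::field \<Rightarrow> int \<Rightarrow> int \<Rightarrow> 'a" where
  "sl_monom c k = (\<lambda>n. if n = k then c else 0)"

text \<open>Subtracting two terms, instead of distinguishing cases, gives \<open>1 - b\<close> for
  \<open>m = 0\<close>, the value from which the induction in \<open>binom_norm_mem\<close>
  starts.\<close>

definition sl_binom :: "nat \<Rightarrow> 'a::field \<Rightarrow> int \<Rightarrow> 'a" where
  "sl_binom m b = (\<lambda>n. (if n = int m then 1 else 0) - (if n = 0 then b else 0))"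

text \<open>These are the remainders modulo a binomial of degree \<open>m\<close>, the left span of
  \<open>1, x, ..., x^(m-1)\<close>.\<close>

definition sl_reduced :: "nat \<Rightarrow> (int \<Rightarrow> 'a::field) \<Rightarrow> bool" where
  "sl_reduced m f \<longleftrightarrow> (\<forall>n. f n \<noteq> 0 \<longrightarrow> 0 \<le> n \<and> n < int m)"

lemma sl_reducedD: "sl_reduced m f \<Longrightarrow> f n \<noteq> 0 \<Longrightarrow> 0 \<le> n \<and> n < int m"
  by (simp add: sl_reduced_def)

lemma sl_reduced_finite: "sl_reduced m f \<Longrightarrow> finite {n. f n \<noteq> 0}"
  by (rule finite_subset[of _ "{0..<int m}"]) (auto simp: sl_reduced_def)

section \<open>Coefficients of products with monomials and binomials\<close>

context field_aut begin

abbreviation (input) L :: "(int \<Rightarrow> 'a) ring" where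
  "L \<equiv> skew_laurent s"

sublocale L: ring L by (rule ring_skew_laurent)

lemma iter_uminus: "int_iter s i (- a) = - int_iter s i a"
  using iter_plus[of i "- a" a] by (simp add: eq_neg_iff_add_eq_0)

lemma iter_minus: "int_iter s i (a - b) = int_iter s i a - int_iter s i b"
  using iter_plus[of i a "- b"] by (simp add: iter_uminus)

lemma iter_eq_0_iff [simp]: "int_iter s i a = 0 \<longleftrightarrow> a = 0"
proof -
  have "inj (int_iter s i)" using field_aut.bij_s[OF field_aut_iter] by (rule bij_is_inj)
  then show ?thesis using inj_eq[of "int_iter s i" a 0] by simp
qed

lemma L_carrier_iff: "f \<in> carrier L \<longleftrightarrow> finite {n. f n \<noteq> 0}"
  by (simp add: skew_laurent_def)

lemma L_add: "f \<oplus>\<^bsub>L\<^esub> g = (\<lambda>n. f n + g n)"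
  by (simp add: skew_laurent_def)

lemma L_zero: "\<zero>\<^bsub>L\<^esub> = (\<lambda>n. 0)"
  by (simp add: skew_laurent_def)

lemma L_one: "\<one>\<^bsub>L\<^esub> = sl_monom 1 0"
  by (simp add: skew_laurent_def sl_monom_def)

lemma L_uminus:
  assumes "f \<in> carrier L" shows "\<ominus>\<^bsub>L\<^esub> f = (\<lambda>n. - f n)"
  by (rule L.minus_equality) (use assms in \<open>auto simp: L_add L_zero L_carrier_iff\<close>)

lemma L_minus:
  assumes "f \<in> carrier L" "g \<in> carrier L" shows "f \<ominus>\<^bsub>L\<^esub> g = (\<lambda>n. f n - g n)"
  using assms by (simp add: a_minus_def L_uminus L_add)

lemma monom_carrier [simp]: "sl_monom c k \<in> carrier L"
  unfolding L_carrier_iff by (rule finite_subset[of _ "{k}"]) (auto simp: sl_monom_def)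

lemma binom_carrier [simp]: "sl_binom m b \<in> carrier L"
  unfolding L_carrier_iff
  by (rule finite_subset[of _ "{int m, 0}"]) (auto simp: sl_binom_def)

lemma binom_eq: "sl_binom m b = sl_monom 1 (int m) \<oplus>\<^bsub>L\<^esub> sl_monom (- b) 0"
  by (auto simp: sl_binom_def sl_monom_def L_add)

lemma reduced_carrier: "sl_reduced m f \<Longrightarrow> f \<in> carrier L"
  by (simp add: L_carrier_iff sl_reduced_finite)

lemma mult_monom_right:
  assumes "f \<in> carrier L"
  shows "(f \<otimes>\<^bsub>L\<^esub> sl_monom c k) n = f (n - k) * int_iter s (n - k) c"
proof -
  have fin: "finite (insert (n - k) {i. f i \<noteq> 0})" using assms by (simp add: L_carrier_iff)
  have "(f \<otimes>\<^bsub>L\<^esub> sl_monom c k) n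
      = (\<Sum>i\<in>insert (n - k) {i. f i \<noteq> 0}. f i * int_iter s i (sl_monom c k (n - i)))"
    by (rule sl_mult_eq[OF fin]) auto
  also have "\<dots> = (\<Sum>i\<in>insert (n - k) {i. f i \<noteq> 0}.
      if i = n - k then f (n - k) * int_iter s (n - k) c else 0)"
    by (intro sum.cong[OF refl]) (auto simp: sl_monom_def)
  also have "\<dots> = f (n - k) * int_iter s (n - k) c"
    using fin by (subst sum.delta) auto
  finally show ?thesis .
qed

lemma mult_monom_left:
  "(sl_monom c k \<otimes>\<^bsub>L\<^esub> g) n = c * int_iter s k (g (n - k))"
  by (subst sl_mult_eq[of "{k}"]) (auto simp: sl_monom_def)

lemma mult_binom_right:
  assumes "f \<in> carrier L"
  shows "(f \<otimes>\<^bsub>L\<^esub> sl_binom m b) n = f (n - int m) - f n * int_iter s n b"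
  unfolding binom_eq L.r_distr[OF monom_carrier monom_carrier assms] unfolding L_add
  by (simp add: mult_monom_right assms iter_uminus)

lemma mult_binom_left:
  assumes "f \<in> carrier L"
  shows "(sl_binom m b \<otimes>\<^bsub>L\<^esub> f) n = int_iter s (int m) (f (n - int m)) - b * f n"
  unfolding binom_eq L.l_distr[OF monom_carrier monom_carrier assms] unfolding L_add
  by (simp add: mult_monom_left)

lemma monom_Units:
  assumes "c \<noteq> 0" shows "sl_monom c 0 \<in> Units L"
proof -
  have "sl_monom a 0 \<otimes>\<^bsub>L\<^esub> sl_monom b 0 = \<one>\<^bsub>L\<^esub>" if "a * b = 1" for a b
    by (rule ext) (use that in \<open>simp add: mult_monom_left, simp add: L_one sl_monom_def\<close>)
  from this[of "inverse c" c] this[of c "inverse c"] show ?thesis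
    using assms by (auto simp: Units_def intro!: bexI[of _ "sl_monom (inverse c) 0"])
qed

section \<open>Reduction modulo a left ideal containing a binomial\<close>

context
  fixes J assumes J: "left_ideal J L"
begin

interpretation J: left_ideal J L by (rule J)

lemma ideal_carrier: "f \<in> J \<Longrightarrow> f \<in> carrier L"
  using J.a_subset by blast

lemma ideal_add: "f \<in> J \<Longrightarrow> g \<in> J \<Longrightarrow> (\<lambda>n. f n + g n) \<in> J"
  using J.a_closed[of f g] by (simp add: L_add)

lemma ideal_uminus: "f \<in> J \<Longrightarrow> (\<lambda>n. - f n) \<in> J"
  using J.a_inv_closed[of f] ideal_carrier[of f] by (simp add: L_uminus)

lemma ideal_diff: "f \<in> J \<Longrightarrow> g \<in> J \<Longrightarrow> (\<lambda>n. f n - g n) \<in> J"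
  using ideal_add[OF _ ideal_uminus, of f g] by simp

lemma ideal_monom_mult: "f \<in> J \<Longrightarrow> (\<lambda>n. c * int_iter s k (f (n - k))) \<in> J"
  using J.I_l_closed[of f "sl_monom c k"] by (simp flip: mult_monom_left)

lemma ideal_scale: "f \<in> J \<Longrightarrow> (\<lambda>n. c * f n) \<in> J"
  using ideal_monom_mult[of f c 0] by simp

lemma ideal_zero: "(\<lambda>n. 0) \<in> J"
  using J.zero_closed by (simp add: L_zero)

text \<open>With \<open>s^m\<close> applied to coefficients, \<open>x^m v = s^m(v) x^m\<close>, and
  modulo the ideal the right factor \<open>x^m\<close> may be replaced by \<open>b\<close>. The
  difference is the left multiple \<open>s^m(v) (x^m - b)\<close>.\<close>

lemma ideal_binom_twist:
  assumes B: "sl_binom m b \<in> J" and v: "v \<in> carrier L"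
  shows "(\<lambda>n. int_iter s (int m) (v (n - int m)) - int_iter s (int m) (v n) * int_iter s n b) \<in> J"
proof -
  have c: "(\<lambda>n. int_iter s (int m) (v n)) \<in> carrier L" using v by (simp add: L_carrier_iff)
  from J.I_l_closed[OF B c] show ?thesis
    by (simp flip: mult_binom_right[OF c])
qed

text \<open>Modulo \<open>x\<^sup>m - b\<close>, left multiplication by \<open>x\<^sup>m\<close> acts diagonally.\<close>

lemma ideal_twist:
  assumes B: "sl_binom m b \<in> J" and f: "f \<in> J"
  shows "(\<lambda>n. int_iter s (int m) (f n) * int_iter s n b) \<in> J"
  using ideal_diff[OF ideal_monom_mult[OF f, of 1 "int m"] ideal_binom_twist[OF B ideal_carrier[OF f]]]
  by simp

text \<open>Multiplying \<open>x^m - b\<close> by \<open>c x^n\<close> makes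
  \<open>c x^(n+m)\<close> congruent to \<open>c s^n(b) x^n\<close>. Lowering an exponent by
  \<open>m\<close> multiplies the coefficient by \<open>s^n(b)\<close>; raising it divides by this
  element, which is nonzero because \<open>b\<close> is.\<close>

lemma ideal_reduce_monom:
  assumes B: "sl_binom m b \<in> J" and b: "b \<noteq> 0"
  shows "\<exists>c'. (\<lambda>i. sl_monom c (k + j * int m) i - sl_monom c' k i) \<in> J"
proof -
  have step: "(\<lambda>i. sl_monom c (n + int m) i - sl_monom (c * int_iter s n b) n i) \<in> J" for c n
    using ideal_monom_mult[OF B, of c n]
    by (rule back_subst[of "\<lambda>f. f \<in> J"])
      (auto simp: sl_binom_def sl_monom_def fun_eq_iff iter_minus iter_uminus right_diff_distrib)
  show ?thesis
  proof (induction j arbitrary: c rule: int_induct[where k = 0])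
    case base
    then show ?case using ideal_zero by (auto intro!: exI[of _ c])
  next
    case (step1 j)
    obtain c' where
      "(\<lambda>i. sl_monom (c * int_iter s (k + j * int m) b) (k + j * int m) i - sl_monom c' k i) \<in> J"
      using step1 by blast
    from ideal_add[OF step[of c "k + j * int m"] this] show ?case
      by (auto intro!: exI[of _ c'] simp: algebra_simps)
  next
    case (step2 j)
    let ?n = "k + (j - 1) * int m"
    let ?d = "c / int_iter s ?n b"
    have n: "?n + int m = k + j * int m" by (simp add: algebra_simps)
    have d: "?d * int_iter s ?n b = c" using b by simp
    obtain c' where "(\<lambda>i. sl_monom ?d (k + j * int m) i - sl_monom c' k i) \<in> J"
      using step2 by blast
    from ideal_diff[OF this step[of ?d ?n, unfolded n d]] show ?case
      by (auto intro!: exI[of _ c'] simp: algebra_simps)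
  qed
qed

text \<open>Division with remainder, one term at a time: the term at \<open>k\<close> moves to the
  exponent \<open>k mod m\<close>.\<close>

lemma ideal_reduce:
  assumes B: "sl_binom m b \<in> J" and b: "b \<noteq> 0" and m: "m > 0" and f: "f \<in> carrier L"
  shows "\<exists>f'. sl_reduced m f' \<and> (\<lambda>n. f n - f' n) \<in> J"
proof -
  have "\<exists>f'. sl_reduced m f' \<and> (\<lambda>n. f n - f' n) \<in> J"
    if "finite A" "{n. f n \<noteq> 0} \<subseteq> A" for A f
    using that
  proof (induction A arbitrary: f rule: finite_induct)
    case empty
    then have "f = (\<lambda>n. 0)" by auto
    then show ?case using ideal_zero by (auto intro!: exI[of _ "\<lambda>n. 0"] simp: sl_reduced_def)
  next
    case (insert k A)
    have "{n. (f(k := 0)) n \<noteq> 0} \<subseteq> A" using insert.prems by auto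
    from insert.IH[OF this] obtain f'
      where f': "sl_reduced m f'" "(\<lambda>n. (f(k := 0)) n - f' n) \<in> J" by blast
    obtain c where c: "(\<lambda>i. sl_monom (f k) (k mod int m + k div int m * int m) i
        - sl_monom c (k mod int m) i) \<in> J"
      using ideal_reduce_monom[OF B b] by blast
    let ?g = "\<lambda>n. f' n + sl_monom c (k mod int m) n"
    have "sl_reduced m ?g"
      using f'(1) m by (auto simp: sl_reduced_def sl_monom_def)
    moreover have "(\<lambda>n. f n - ?g n) \<in> J"
      using ideal_add[OF f'(2) c]
      by (rule back_subst[of "\<lambda>f. f \<in> J"]) (auto simp: sl_monom_def fun_eq_iff)
    ultimately show ?case by blast
  qed
  then show ?thesis using f by (auto simp: L_carrier_iff)
qed

end

text \<open>A nonzero multiple of \<open>x\<^sup>m - b\<close> has extreme exponents at distance at least \<open>m\<close>.\<close>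

lemma reduced_binom_multiple_eq_0:
  assumes b: "b \<noteq> 0" and f: "f \<in> left_principal L (sl_binom m b)" and red: "sl_reduced m f"
  shows "f = (\<lambda>n. 0)"
proof (rule ccontr)
  assume f0: "f \<noteq> (\<lambda>n. 0)"
  obtain r where r: "r \<in> carrier L" "f = r \<otimes>\<^bsub>L\<^esub> sl_binom m b"
    using f by (auto simp: left_principal_def)
  have f_eq: "f n = r (n - int m) - r n * int_iter s n b" for n
    unfolding r(2) by (rule mult_binom_right[OF r(1)])
  let ?S = "{n. r n \<noteq> 0}"
  have fin: "finite ?S" using r(1) by (simp add: L_carrier_iff)
  have ne: "?S \<noteq> {}" using f0 f_eq by auto
  have m: "m > 0" using f0 red by (auto simp: sl_reduced_def fun_eq_iff)
  let ?N = "Max ?S" and ?n = "Min ?S"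
  have N: "r ?N \<noteq> 0" "r ?n \<noteq> 0" using Max_in[OF fin ne] Min_in[OF fin ne] by auto
  \<comment> \<open>The top term of \<open>r\<close> times \<open>x^m\<close> and the bottom term of
    \<open>r\<close> times \<open>b\<close> cannot cancel, so \<open>?N + m\<close> and
    \<open>?n\<close> are exponents of \<open>f\<close>. Reducedness then forces
    \<open>?N < 0\<close> and \<open>0 <= ?n\<close>.\<close>
  have "r (?N + int m) = 0" using Max_ge[OF fin, of "?N + int m"] m by force
  then have "f (?N + int m) \<noteq> 0" using f_eq[of "?N + int m"] N by simp
  then have "?N < 0" using sl_reducedD[OF red] by fastforce
  moreover have "r (?n - int m) = 0" using Min_le[OF fin, of "?n - int m"] m by force
  then have "f ?n \<noteq> 0" using f_eq[of ?n] N b by simp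
  then have "0 \<le> ?n" using sl_reducedD[OF red] by blast
  moreover have "?n \<le> ?N" using Max_ge[OF fin] N by simp
  ultimately show False by linarith
qed

lemma one_not_in_binom_ideal:
  assumes "b \<noteq> 0" "m > 0" shows "\<one>\<^bsub>L\<^esub> \<notin> left_principal L (sl_binom m b)"
proof
  assume "\<one>\<^bsub>L\<^esub> \<in> left_principal L (sl_binom m b)"
  from reduced_binom_multiple_eq_0[OF assms(1) this] have "\<one>\<^bsub>L\<^esub> = (\<lambda>n. 0)"
    using assms(2) by (auto simp: L_one sl_reduced_def sl_monom_def)
  from fun_cong[OF this, of 0] show False by (simp add: L_one sl_monom_def)
qed

section \<open>Simplicity of the quotients and homomorphisms between them\<close>

text \<open>Here \<open>v\<close> is the scalar of an isomorphism between two lines on which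
  \<open>x^m\<close> acts through \<open>a\<close> and \<open>b\<close>; equivalently,
  \<open>a\<close> is \<open>b\<close> times the factor \<open>s^m(v) / v\<close>.\<close>

definition twisted_equiv :: "nat \<Rightarrow> 'a \<Rightarrow> 'a \<Rightarrow> bool" where
  "twisted_equiv m a b \<longleftrightarrow> (\<exists>v. v \<noteq> 0 \<and> int_iter s (int m) v * b = a * v)"

text \<open>In a larger left ideal, a nonzero reduced element of minimal support is a monomial: otherwise
  twisting it and cancelling its lowest term would give a shorter one.\<close>

lemma maximal_left_ideal_binom:
  assumes m: "m > 0" and b: "b \<noteq> 0"
    and reg: "\<And>k. 0 < k \<Longrightarrow> k < int m \<Longrightarrow> \<not> twisted_equiv m b (int_iter s k b)"
  shows "maximal_left_ideal (left_principal L (sl_binom m b)) L"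
    (is "maximal_left_ideal ?I L")
proof (intro maximal_left_ideal.intro maximal_left_ideal_axioms.intro)
  show I: "left_ideal ?I L" by (rule L.left_ideal_left_principal) simp
  show "carrier L \<noteq> ?I" using one_not_in_binom_ideal[OF b m] by auto
  fix J assume J: "left_ideal J L" and IJ: "?I \<subseteq> J"
  interpret J: left_ideal J L by (rule J)
  have B: "sl_binom m b \<in> J" using IJ L.left_principal_self[of "sl_binom m b"] by auto
  let ?P = "\<lambda>f. f \<in> J \<and> f \<noteq> (\<lambda>n. 0) \<and> sl_reduced m f"
  show "J = ?I \<or> J = carrier L"
  proof (cases "J \<subseteq> ?I")
    case True
    then show ?thesis using IJ by blast
  next
    case False
    then obtain f0 where f0: "f0 \<in> J" "f0 \<notin> ?I" by blast
    obtain f1 where f1: "sl_reduced m f1" "(\<lambda>n. f0 n - f1 n) \<in> ?I"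
      using ideal_reduce[OF I L.left_principal_self[OF binom_carrier] b m ideal_carrier[OF J f0(1)]] by blast
    have "f1 \<in> J" using ideal_diff[OF J f0(1), of "\<lambda>n. f0 n - f1 n"] f1(2) IJ by auto
    moreover have "f1 \<noteq> (\<lambda>n. 0)" using f1(2) f0(2) by auto
    ultimately have "?P f1" using f1(1) by simp
    then obtain f where f: "?P f" and least: "\<And>g. ?P g \<Longrightarrow> card {n. f n \<noteq> 0} \<le> card {n. g n \<noteq> 0}"
      using ex_has_least_nat[of ?P f1 "\<lambda>f. card {n. f n \<noteq> 0}"] by blast
    have fin: "finite {n. f n \<noteq> 0}" using f sl_reduced_finite by blast
    have ne: "{n. f n \<noteq> 0} \<noteq> {}" using f by (auto simp: fun_eq_iff)
    define k where "k = Min {n. f n \<noteq> 0}"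
    have fk: "f k \<noteq> 0" using Min_in[OF fin ne] by (simp add: k_def)
    have k_le: "k \<le> n" if "f n \<noteq> 0" for n using Min_le[OF fin, of n] that by (simp add: k_def)
    define g where "g = (\<lambda>n. inverse (f k) * f n)"
    have g: "g \<in> J" "g k = 1" "\<And>n. g n \<noteq> 0 \<longleftrightarrow> f n \<noteq> 0"
      using ideal_scale[OF J] f fk by (auto simp: g_def)
    \<comment> \<open>As \<open>g\<close> has coefficient 1 at \<open>k\<close>, twisting multiplies
      that coefficient by exactly \<open>s^k(b)\<close>. The difference vanishes at
      \<open>k\<close>, so its support is strictly smaller than that of \<open>f\<close>.\<close>
    define t where "t = (\<lambda>n. int_iter s (int m) (g n) * int_iter s n b - int_iter s k b * g n)"
    have "t \<in> J"
      unfolding t_def by (intro ideal_diff[OF J] ideal_twist[OF J B] ideal_scale[OF J] g(1))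
    moreover have tk: "t k = 0" by (simp add: t_def g(2))
    have "t n = 0" if "f n = 0" for n
      using that g(3)[of n] by (simp add: t_def)
    then have t_supp: "{n. t n \<noteq> 0} \<subseteq> {n. f n \<noteq> 0} - {k}"
      using tk by auto
    have "card {n. t n \<noteq> 0} < card {n. f n \<noteq> 0}"
      using fin fk t_supp by (intro psubset_card_mono) auto
    moreover have "sl_reduced m t" using t_supp f by (auto simp: sl_reduced_def)
    ultimately have t0: "t = (\<lambda>n. 0)" using least[of t] by force
    have only_k: "g n = 0" if "n \<noteq> k" for n
    proof (rule ccontr)
      assume gn: "g n \<noteq> 0"
      then have fn: "f n \<noteq> 0" using g(3) by simp
      have "k < n" using k_le[OF fn] that by simp
      moreover have "n - k < int m"
        using sl_reducedD[of m f n] sl_reducedD[of m f k] f fn fk by simp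
      moreover have "twisted_equiv m b (int_iter s (n - k) b)"
        unfolding twisted_equiv_def
      \<comment> \<open>Applying \<open>s^(-k)\<close> to the equation at \<open>n\<close> turns a
        comparison of \<open>s^k(b)\<close> with \<open>s^n(b)\<close> into one of \<open>b\<close>
        with \<open>s^(n-k)(b)\<close>, to which \<open>reg\<close> applies.\<close>
      proof (intro exI[of _ "int_iter s (- k) (g n)"] conjI)
        show "int_iter s (- k) (g n) \<noteq> 0" using gn by simp
        have "int_iter s (- k) (int_iter s (int m) (g n) * int_iter s n b)
            = int_iter s (- k) (int_iter s k b * g n)"
          using fun_cong[OF t0, of n] by (simp add: t_def)
        then show "int_iter s (int m) (int_iter s (- k) (g n)) * int_iter s (n - k) b
            = b * int_iter s (- k) (g n)"
          by (simp add: iter_times add.commute flip: iter_add)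
      qed
      ultimately show False using reg[of "n - k"] by simp
    qed
    \<comment> \<open>At this point \<open>g = x^k\<close>, and multiplication by
      \<open>x^(-k)\<close> puts 1 into \<open>J\<close>.\<close>
    have "(\<lambda>n. 1 * int_iter s (- k) (g (n - (- k)))) \<in> J"
      by (rule ideal_monom_mult[OF J g(1)])
    also have "(\<lambda>n. 1 * int_iter s (- k) (g (n - (- k)))) = \<one>\<^bsub>L\<^esub>"
      using only_k g(2) by (auto simp: L_one sl_monom_def)
    finally show ?thesis using L.left_ideal_eq_carrier[OF J] by simp
  qed
qed

text \<open>The left side describes a nonzero homomorphism between the two quotients. Once
  \<open>v\<close> is replaced by its remainder \<open>u\<close>, \<open>x^m\<close> acts
  diagonally, and the condition splits into one twisted equation for each coefficient of
  \<open>u\<close>.\<close>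

lemma binom_hom_iff:
  assumes m: "m > 0" and b: "b \<noteq> 0"
  shows "(\<exists>v\<in>carrier L. v \<notin> left_principal L (sl_binom m b) \<and>
        sl_binom m a \<otimes>\<^bsub>L\<^esub> v \<in> left_principal L (sl_binom m b)) \<longleftrightarrow>
      (\<exists>k. 0 \<le> k \<and> k < int m \<and> twisted_equiv m a (int_iter s k b))"
    (is "(\<exists>v\<in>_. v \<notin> ?I \<and> _ \<in> ?I) \<longleftrightarrow> _")
proof
  have I: "left_ideal ?I L" by (rule L.left_ideal_left_principal) simp
  interpret I: left_ideal ?I L by (rule I)
  have B: "sl_binom m b \<in> ?I" by (simp add: L.left_principal_self)
  {
    assume "\<exists>v\<in>carrier L. v \<notin> ?I \<and> sl_binom m a \<otimes>\<^bsub>L\<^esub> v \<in> ?I"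
    then obtain v where v: "v \<in> carrier L" "v \<notin> ?I" "sl_binom m a \<otimes>\<^bsub>L\<^esub> v \<in> ?I" by blast
    obtain u where u: "sl_reduced m u" "(\<lambda>n. v n - u n) \<in> ?I"
      using ideal_reduce[OF I B b m v(1)] by blast
    have u0: "u \<noteq> (\<lambda>n. 0)" using u(2) v(2) by auto
    have uc: "u \<in> carrier L" using u(1) by (rule reduced_carrier)
    have d: "v \<ominus>\<^bsub>L\<^esub> u \<in> ?I" using u(2) by (simp add: L_minus[OF v(1) uc])
    have "sl_binom m a \<otimes>\<^bsub>L\<^esub> (v \<ominus>\<^bsub>L\<^esub> u) \<in> ?I"
      using I.I_l_closed[OF d binom_carrier] .
    from ideal_diff[OF I v(3) this]
    have "(\<lambda>n. (sl_binom m a \<otimes>\<^bsub>L\<^esub> v) n - (sl_binom m a \<otimes>\<^bsub>L\<^esub> (v \<ominus>\<^bsub>L\<^esub> u)) n) \<in> ?I" .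
    also have "(\<lambda>n. (sl_binom m a \<otimes>\<^bsub>L\<^esub> v) n - (sl_binom m a \<otimes>\<^bsub>L\<^esub> (v \<ominus>\<^bsub>L\<^esub> u)) n)
        = (\<lambda>n. int_iter s (int m) (u (n - int m)) - a * u n)"
      using v(1) uc by (simp add: mult_binom_left, simp add: L_minus iter_minus algebra_simps)
    finally have "(\<lambda>n. int_iter s (int m) (u (n - int m)) - a * u n) \<in> ?I" .
    from ideal_diff[OF I this ideal_binom_twist[OF I B uc]]
    have "(\<lambda>n. int_iter s (int m) (u n) * int_iter s n b - a * u n) \<in> ?I" by simp
    moreover have "sl_reduced m (\<lambda>n. int_iter s (int m) (u n) * int_iter s n b - a * u n)"
      unfolding sl_reduced_def
    proof (intro allI impI)
      fix n assume "int_iter s (int m) (u n) * int_iter s n b - a * u n \<noteq> 0"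
      then have "u n \<noteq> 0" by force
      then show "0 \<le> n \<and> n < int m" by (rule sl_reducedD[OF u(1)])
    qed
    \<comment> \<open>The expression is a reduced multiple of \<open>x^m - b\<close>, hence zero;
      any nonzero coefficient of \<open>u\<close> is then a witness.\<close>
    ultimately have eq: "(\<lambda>n. int_iter s (int m) (u n) * int_iter s n b - a * u n) = (\<lambda>n. 0)"
      using reduced_binom_multiple_eq_0[OF b] by blast
    obtain k where k: "u k \<noteq> 0" using u0 by auto
    have "int_iter s (int m) (u k) * int_iter s k b = a * u k"
      using fun_cong[OF eq, of k] by simp
    then have "twisted_equiv m a (int_iter s k b)"
      unfolding twisted_equiv_def using k by blast
    then show "\<exists>k. 0 \<le> k \<and> k < int m \<and> twisted_equiv m a (int_iter s k b)"
      using sl_reducedD[OF u(1) k] by blast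
  next
    assume "\<exists>k. 0 \<le> k \<and> k < int m \<and> twisted_equiv m a (int_iter s k b)"
    then obtain k c where k: "0 \<le> k" "k < int m"
      and c: "c \<noteq> 0" "int_iter s (int m) c * int_iter s k b = a * c"
      unfolding twisted_equiv_def by blast
    let ?v = "sl_monom c k"
    have "?v \<notin> ?I"
    proof
      assume "?v \<in> ?I"
      moreover have "sl_reduced m ?v" using k by (simp add: sl_reduced_def sl_monom_def)
      ultimately have "?v = (\<lambda>n. 0)" using reduced_binom_multiple_eq_0[OF b] by blast
      from fun_cong[OF this, of k] show False using c by (simp add: sl_monom_def)
    qed
    \<comment> \<open>The equation for \<open>c\<close> reads \<open>s^m(c) s^k(b) = a c\<close>, so
      for this monomial the product is the element supplied by
      \<open>ideal_binom_twist\<close>.\<close>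
    moreover have "sl_binom m a \<otimes>\<^bsub>L\<^esub> ?v
        = (\<lambda>n. int_iter s (int m) (?v (n - int m)) - int_iter s (int m) (?v n) * int_iter s n b)"
      by (rule ext, simp add: mult_binom_left) (use c in \<open>auto simp: sl_monom_def\<close>)
    then have "sl_binom m a \<otimes>\<^bsub>L\<^esub> ?v \<in> ?I"
      using ideal_binom_twist[OF I B monom_carrier] by simp
    ultimately show "\<exists>v\<in>carrier L. v \<notin> ?I \<and> sl_binom m a \<otimes>\<^bsub>L\<^esub> v \<in> ?I"
      using monom_carrier by blast
  }
qed

lemma left_irreducible_binom_iff:
  assumes "m > 0"
  shows "left_irreducible L (sl_binom m b) \<longleftrightarrow>
    maximal_left_ideal (left_principal L (sl_binom m b)) L"
proof -
  have "sl_binom m b \<noteq> \<zero>\<^bsub>L\<^esub>"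
  proof
    assume "sl_binom m b = \<zero>\<^bsub>L\<^esub>"
    from fun_cong[OF this, of "int m"] show False using assms by (simp add: L_zero sl_binom_def)
  qed
  then show ?thesis using L.left_irreducible_iff[OF binom_carrier] by blast
qed

lemma left_similar_binom_iff:
  assumes m: "m > 0" and b: "b \<noteq> 0"
    and "left_irreducible L (sl_binom m a)" "left_irreducible L (sl_binom m b)"
  shows "left_similar L (sl_binom m a) (sl_binom m b) \<longleftrightarrow>
    (\<exists>k. 0 \<le> k \<and> k < int m \<and> twisted_equiv m a (int_iter s k b))"
  using assms L.left_module_iso_quotient_iff[of "sl_binom m a" "left_principal L (sl_binom m b)"]
  unfolding binom_hom_iff[OF m b, symmetric]
  by (simp add: left_similar_def left_irreducible_binom_iff)

section \<open>Transfer of irreducibility, and reducible binomials\<close>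

text \<open>A witness \<open>v\<close> gives \<open>(x^m - a) v = s^m(v) (x^m - b)\<close>, so the
  two binomials differ by units on the two sides.\<close>

lemma left_irreducible_binom_twisted_equiv:
  assumes irr: "left_irreducible L (sl_binom m a)" and eq: "twisted_equiv m a b"
  shows "left_irreducible L (sl_binom m b)"
proof -
  obtain v where v: "v \<noteq> 0" "int_iter s (int m) v * b = a * v"
    using eq by (auto simp: twisted_equiv_def)
  have "sl_binom m a \<otimes>\<^bsub>L\<^esub> sl_monom v 0 = sl_monom (int_iter s (int m) v) 0 \<otimes>\<^bsub>L\<^esub> sl_binom m b"
    by (rule ext, simp add: mult_binom_left mult_monom_left)
      (use v(2) in \<open>auto simp: sl_monom_def sl_binom_def iter_minus iter_uminus right_diff_distrib\<close>)
  then show ?thesis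
    by (intro L.left_irreducible_associated[OF irr binom_carrier monom_Units monom_Units])
      (use v(1) in simp_all)
qed

text \<open>For \<open>b = 0\<close> the binomial is \<open>x^m\<close>, and multiplication by
  \<open>x^(-m)\<close> puts 1 into its ideal.\<close>

lemma left_irreducible_binom_nonzero:
  assumes m: "m > 0" and irr: "left_irreducible L (sl_binom m b)"
  shows "b \<noteq> 0"
proof
  assume "b = 0"
  then have "sl_monom 1 (- int m) \<otimes>\<^bsub>L\<^esub> sl_binom m b = \<one>\<^bsub>L\<^esub>"
    by (intro ext) (simp add: mult_monom_left, simp add: L_one sl_monom_def sl_binom_def)
  then have "\<one>\<^bsub>L\<^esub> \<in> left_principal L (sl_binom m b)"
    using L.left_principalI[OF monom_carrier, of 1 "- int m" "sl_binom m b"] by simp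
  then show False
    using irr L.maximal_left_ideal_iff[OF L.left_ideal_left_principal[OF binom_carrier]]
    by (auto simp: left_irreducible_def)
qed

text \<open>\<open>N j\<close> is the norm \<open>c \<sigma>\<^sup>d(c) \<sigma>\<^sup>2\<^sup>d(c) \<dots>\<close> with \<open>j\<close> factors.\<close>

lemma binom_norm_mem:
  assumes "N 0 = 1" "\<And>j. N (Suc j) = int_iter s (int d) (N j) * c"
  shows "sl_binom (j * d) (N j) \<in> left_principal L (sl_binom d c)"
proof (induction j)
  have I: "left_ideal (left_principal L (sl_binom d c)) L"
    by (rule L.left_ideal_left_principal) simp
  {
    case 0
    have "sl_binom (0 * d) (N 0) = (\<lambda>n. 0)" by (simp add: sl_binom_def assms(1))
    then show ?case using ideal_zero[OF I] by simp
  next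
    case (Suc j)
    \<comment> \<open>The sum telescopes: \<open>x^d (x^(jd) - N j) + s^d(N j) (x^d - c) =
      x^((j+1)d) - s^d(N j) c\<close>.\<close>
    from ideal_add[OF I ideal_monom_mult[OF I Suc, of 1 "int d"]
      ideal_scale[OF I L.left_principal_self[OF binom_carrier], of "int_iter s (int d) (N j)"]]
    show ?case
      by (rule back_subst[of "\<lambda>f. f \<in> left_principal L (sl_binom d c)"])
        (auto simp: sl_binom_def assms(2) fun_eq_iff iter_minus algebra_simps)
  }
qed

text \<open>The ideal of \<open>x^d - c\<close> lies strictly between that of \<open>x^m - b\<close>
  and the ring: it does not contain 1, and \<open>x^d - c\<close> itself is a nonzero remainder
  modulo \<open>x^m - b\<close> because \<open>d < m\<close>.\<close>

lemma not_left_irreducible_binom: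
  assumes d: "0 < d" "d < m" and bc: "b \<noteq> 0" "c \<noteq> 0"
    and mem: "sl_binom m b \<in> left_principal L (sl_binom d c)"
  shows "\<not> left_irreducible L (sl_binom m b)"
proof
  let ?I = "left_principal L (sl_binom m b)" and ?J = "left_principal L (sl_binom d c)"
  assume "left_irreducible L (sl_binom m b)"
  then interpret maximal_left_ideal ?I L by (simp add: left_irreducible_def)
  have J: "left_ideal ?J L" by (rule L.left_ideal_left_principal) simp
  interpret J: left_ideal ?J L by (rule J)
  have "?I \<subseteq> ?J"
    unfolding left_principal_def[of L "sl_binom m b"] using J.I_l_closed[OF mem] by blast
  moreover have "?J \<noteq> carrier L" using one_not_in_binom_ideal[OF bc(2) d(1)] by auto
  moreover have "?J \<noteq> ?I"
  proof
    assume "?J = ?I"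
    then have "sl_binom d c \<in> ?I" using L.left_principal_self[OF binom_carrier, of d c] by simp
    moreover have "sl_reduced m (sl_binom d c)"
      using d by (auto simp: sl_reduced_def sl_binom_def split: if_splits)
    ultimately have "sl_binom d c = (\<lambda>n. 0)" using reduced_binom_multiple_eq_0[OF bc(1)] by blast
    from fun_cong[OF this, of "int d"] show False using d by (simp add: sl_binom_def)
  qed
  ultimately show False using I_maximal[OF J] by blast
qed

end


section \<open>Divisors of rational functions\<close>

text \<open>The leading coefficient and the divisor serve as coordinates in which products of
  rational functions become sums. For infinite support the product takes its default value
  1.\<close>

definition rf_div :: "complex \<Rightarrow> (complex \<Rightarrow> int) \<Rightarrow> ratfun" where
  "rf_div c e = rf_const c * (\<Prod>z | e z \<noteq> 0. (rf_h - rf_const z) powi e z)"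

lemma rf_const_mult: "rf_const (a * b) = rf_const a * rf_const b"
  by (simp add: rf_const_def flip: to_fract_mult)

lemma rf_const_add: "rf_const (a + b) = rf_const a + rf_const b"
  by (simp add: rf_const_def flip: to_fract_add)

lemma rf_const_eq_0_iff [simp]: "rf_const c = 0 \<longleftrightarrow> c = 0"
  by (simp add: rf_const_def)

lemma rf_const_1 [simp]: "rf_const 1 = 1"
  by (simp add: rf_const_def one_pCons[symmetric])

lemma rf_linear: "rf_h - rf_const z = to_fract [:- z, 1:]"
  by (simp add: rf_h_def rf_const_def flip: to_fract_diff)

lemma rf_h_neq_const [simp]: "rf_h \<noteq> rf_const z"
  by (simp add: rf_h_def rf_const_def)

lemma to_fract_power: "to_fract (p ^ n) = to_fract p ^ n"
  by (induction n) simp_all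

lemma to_fract_prod: "to_fract (\<Prod>x\<in>A. f x) = (\<Prod>x\<in>A. to_fract (f x))"
  by (induction A rule: infinite_finite_induct) simp_all

lemma rf_div_superset:
  assumes "finite A" "{z. e z \<noteq> 0} \<subseteq> A"
  shows "rf_div c e = rf_const c * (\<Prod>z\<in>A. (rf_h - rf_const z) powi e z)"
  unfolding rf_div_def
  by (rule arg_cong[where f = "\<lambda>x. rf_const c * x"], rule prod.mono_neutral_left) (use assms in auto)

lemma rf_div_nonzero: "c \<noteq> 0 \<Longrightarrow> rf_div c e \<noteq> 0"
  by (cases "finite {z. e z \<noteq> 0}") (simp_all add: rf_div_def)

lemma rf_div_zero: "rf_div 1 (\<lambda>z. 0) = 1"
  by (simp add: rf_div_def)

lemma rf_div_mult:
  assumes "finite {z. e z \<noteq> 0}" "finite {z. e' z \<noteq> 0}"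
  shows "rf_div c e * rf_div c' e' = rf_div (c * c') (\<lambda>z. e z + e' z)"
proof -
  let ?A = "{z. e z \<noteq> 0} \<union> {z. e' z \<noteq> 0}"
  have A: "finite ?A" using assms by simp
  have "rf_div c e = rf_const c * (\<Prod>z\<in>?A. (rf_h - rf_const z) powi e z)"
    "rf_div c' e' = rf_const c' * (\<Prod>z\<in>?A. (rf_h - rf_const z) powi e' z)"
    "rf_div (c * c') (\<lambda>z. e z + e' z)
      = rf_const (c * c') * (\<Prod>z\<in>?A. (rf_h - rf_const z) powi (e z + e' z))"
    by (rule rf_div_superset[OF A]; auto)+
  then show ?thesis by (simp add: rf_const_mult power_int_add prod.distrib)
qed

lemma finite_supp_add:
  fixes e e' :: "complex \<Rightarrow> int"
  assumes "finite {z. e z \<noteq> 0}" "finite {z. e' z \<noteq> 0}"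
  shows "finite {z. e z + e' z \<noteq> 0}"
  by (rule finite_subset[of _ "{z. e z \<noteq> 0} \<union> {z. e' z \<noteq> 0}"]) (use assms in auto)

lemma finite_supp_shift:
  fixes e :: "complex \<Rightarrow> int"
  assumes "finite {z. e z \<noteq> 0}"
  shows "finite {z. e (z - a) \<noteq> 0}"
proof -
  have "z \<in> (\<lambda>z. z + a) ` {z. e z \<noteq> 0}" if "e (z - a) \<noteq> 0" for z
    using that by (auto intro!: image_eqI[of _ _ "z - a"])
  then show ?thesis by (intro finite_subset[OF _ finite_imageI[OF assms]]) blast
qed

lemma rf_div_of_nat:
  assumes "finite {z. n z \<noteq> 0}"
  shows "rf_div c (\<lambda>z. int (n z)) = to_fract (Polynomial.smult c (\<Prod>z | n z \<noteq> 0. [:- z, 1:] ^ n z))"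
proof -
  have "to_fract (Polynomial.smult c p) = rf_const c * to_fract p" for p
    by (simp add: rf_const_def flip: to_fract_mult)
  then show ?thesis by (simp add: rf_div_def rf_linear to_fract_prod to_fract_power)
qed

lemma order_linear_prod:
  fixes w :: "'a::idom"
  assumes "finite A"
  shows "Polynomial.order w (\<Prod>z\<in>A. [:- z, 1:] ^ n z) = (if w \<in> A then n w else 0)"
  using assms
proof (induction A rule: finite_induct)
  case empty
  then show ?case by (simp add: order_0I)
next
  case (insert z A)
  have nz: "(\<Prod>z\<in>A. [:- z, 1:] ^ n z) \<noteq> 0" using insert.hyps by simp
  have "Polynomial.order w ([:- z, 1:] ^ n z) = (if w = z then n w else 0)"
    by (auto simp: order_power_n_n intro!: order_0I)
  then show ?case
    using insert order_mult[of "[:- z, 1:] ^ n z" "\<Prod>z\<in>A. [:- z, 1:] ^ n z" w] nz by auto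
qed

text \<open>The leading coefficient of the polynomial recovers \<open>c\<close>, and its order at
  \<open>w\<close> recovers \<open>n w\<close>.\<close>

lemma rf_div_of_nat_inject:
  assumes n: "finite {z. n z \<noteq> 0}" "finite {z. n' z \<noteq> 0}" and c: "c \<noteq> 0" "c' \<noteq> 0"
    and eq: "rf_div c (\<lambda>z. int (n z)) = rf_div c' (\<lambda>z. int (n' z))"
  shows "c = c' \<and> n = n'"
proof -
  let ?p = "Polynomial.smult c (\<Prod>z | n z \<noteq> 0. [:- z, 1:] ^ n z)"
  let ?p' = "Polynomial.smult c' (\<Prod>z | n' z \<noteq> 0. [:- z, 1:] ^ n' z)"
  have p: "?p = ?p'" using eq n by (simp add: rf_div_of_nat)
  have "lead_coeff ?p = c" "lead_coeff ?p' = c'"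
    by (simp_all add: lead_coeff_prod lead_coeff_power)
  moreover have "Polynomial.order w ?p = n w" "Polynomial.order w ?p' = n' w" for w
    using c n by (auto simp: order_smult order_linear_prod)
  ultimately show ?thesis using p by (metis ext)
qed

text \<open>Multiplying both sides by \<open>rf_div 1 a\<close> with \<open>a = |e| + |e'|\<close>
  clears all poles and reduces the claim to polynomials.\<close>

lemma rf_div_inject:
  assumes e: "finite {z. e z \<noteq> 0}" "finite {z. e' z \<noteq> 0}" and c: "c \<noteq> 0" "c' \<noteq> 0"
    and eq: "rf_div c e = rf_div c' e'"
  shows "c = c' \<and> e = e'"
proof -
  define a where "a = (\<lambda>z. \<bar>e z\<bar> + \<bar>e' z\<bar>)"
  have a: "finite {z. a z \<noteq> 0}"
    unfolding a_def by (rule finite_supp_add) (use e in simp_all)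
  define n where "n = (\<lambda>z. nat (e z + a z))"
  define n' where "n' = (\<lambda>z. nat (e' z + a z))"
  have n: "int (n z) = e z + a z" "int (n' z) = e' z + a z" for z
    by (simp_all add: n_def n'_def a_def)
  have "n z \<noteq> 0 \<longleftrightarrow> e z + a z \<noteq> 0" "n' z \<noteq> 0 \<longleftrightarrow> e' z + a z \<noteq> 0" for z
    using n[of z] by linarith+
  then have fin: "finite {z. n z \<noteq> 0}" "finite {z. n' z \<noteq> 0}"
    using finite_supp_add[OF e(1) a] finite_supp_add[OF e(2) a] by simp_all
  have "rf_div c e * rf_div 1 a = rf_div c' e' * rf_div 1 a" by (simp add: eq)
  then have "rf_div c (\<lambda>z. int (n z)) = rf_div c' (\<lambda>z. int (n' z))"
    by (simp add: rf_div_mult e a n)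
  then have "c = c' \<and> n = n'" by (rule rf_div_of_nat_inject[OF fin c])
  then show ?thesis using n by (auto simp: fun_eq_iff)
qed

text \<open>The complex numbers are algebraically closed, so numerator and denominator split into
  linear factors; the divisor is the difference of their root orders.\<close>

lemma rf_div_surj:
  assumes "q \<noteq> 0"
  obtains c e where "c \<noteq> 0" "finite {z. e z \<noteq> 0}" "q = rf_div c e"
proof -
  have poly: "to_fract p = rf_div (lead_coeff p) (\<lambda>z. int (Polynomial.order z p))"
    "finite {z. int (Polynomial.order z p) \<noteq> 0}" if "p \<noteq> 0" for p :: "complex poly"
  proof -
    have roots: "{z. Polynomial.order z p \<noteq> 0} = {z. poly p z = 0}" using that by (auto simp: order_root)
    have fin: "finite {z. poly p z = 0}" using that by (rule poly_roots_finite)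
    then show "finite {z. int (Polynomial.order z p) \<noteq> 0}" using roots by simp
    show "to_fract p = rf_div (lead_coeff p) (\<lambda>z. int (Polynomial.order z p))"
      using fin roots by (subst rf_div_of_nat) (simp_all add: complex_poly_decompose)
  qed
  obtain a b where q: "q = Fract a b" "b \<noteq> 0" by (cases q)
  have a: "a \<noteq> 0" using assms q by (auto simp: Fract_conv_to_fract)
  let ?ea = "\<lambda>z. int (Polynomial.order z a)" and ?eb = "\<lambda>z. int (Polynomial.order z b)"
  let ?c = "lead_coeff a / lead_coeff b" and ?e = "\<lambda>z. ?ea z + - ?eb z"
  have fin: "finite {z. ?e z \<noteq> 0}"
    by (rule finite_supp_add) (use poly(2)[OF a] poly(2)[OF q(2)] in simp_all)
  have "rf_div ?c ?e * to_fract b = to_fract a"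
    using a q(2) poly(1)[OF a] poly(1)[OF q(2)] rf_div_mult[OF fin poly(2)[OF q(2)]] by simp
  moreover have "q * to_fract b = to_fract a" using q by (simp add: Fract_conv_to_fract)
  moreover have "to_fract b \<noteq> 0" using q(2) by simp
  ultimately have "q = rf_div ?c ?e" by (metis mult_right_cancel)
  then show ?thesis using that[of ?c ?e] fin a q(2) by simp
qed

section \<open>The automorphism acting on divisors\<close>

context field_aut begin

lemma s_power: "s (a ^ n) = s a ^ n"
  by (induction n) (simp_all add: s_mult s_1)

lemma s_inverse: "s (inverse a) = inverse (s a)"
proof (cases "a = 0")
  case False
  then have "s (inverse a) * s a = 1" by (simp add: s_1 flip: s_mult)
  then show ?thesis using inverse_unique[of "s a" "s (inverse a)"] by (simp add: mult.commute)
qed (simp add: s_0)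

lemma s_power_int: "s (a powi n) = s a powi n"
  by (simp add: power_int_def s_power s_inverse)

lemma s_minus: "s (a - b) = s a - s b"
  using s_add[of "a - b" b] by simp

lemma s_prod: "s (\<Prod>x\<in>A. f x) = (\<Prod>x\<in>A. s (f x))"
  by (induction A rule: infinite_finite_induct) (simp_all add: s_mult s_1)

end

lemma sigma_linear: "sigma (rf_h - rf_const z) = rf_h - rf_const (z + 2)"
  by (simp add: sigma.s_minus sigma_h sigma_const rf_const_add)

text \<open>The factor \<open>h - z\<close> becomes \<open>h - (z + 2)\<close>: zeros and poles move
  right by 2, hence the argument \<open>z - 2\<close>.\<close>

lemma sigma_rf_div: "sigma (rf_div c e) = rf_div c (\<lambda>z. e (z - 2))"
proof -
  have "(\<Prod>z | e z \<noteq> 0. (rf_h - rf_const (z + 2)) powi e z)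
      = (\<Prod>z | e (z - 2) \<noteq> 0. (rf_h - rf_const z) powi e (z - 2))"
    by (rule prod.reindex_bij_witness[of _ "\<lambda>z. z - 2" "\<lambda>z. z + 2"]) auto
  then show ?thesis
    by (simp add: rf_div_def sigma.s_mult sigma_const sigma.s_prod sigma.s_power_int sigma_linear)
qed

lemma sigma_iter_rf_div:
  "int_iter sigma (int k) (rf_div c e) = rf_div c (\<lambda>z. e (z - 2 * of_nat k))"
proof -
  have "(sigma ^^ k) (rf_div c e) = rf_div c (\<lambda>z. e (z - 2 * of_nat k))"
    by (induction k) (simp_all add: sigma_rf_div algebra_simps)
  then show ?thesis by (simp add: int_iter_def)
qed

text \<open>The additive form of \<^const>\<open>sigma.twisted_equiv\<close> on divisors.\<close>

definition shift_equiv :: "nat \<Rightarrow> (complex \<Rightarrow> int) \<Rightarrow> (complex \<Rightarrow> int) \<Rightarrow> bool" where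
  "shift_equiv m e e' \<longleftrightarrow>
     (\<exists>u. finite {z. u z \<noteq> 0} \<and> (\<forall>z. u (z - 2 * of_nat m) + e' z = e z + u z))"

text \<open>Write the witness as \<open>rf_div d u\<close>. The constant \<open>d\<close> occurs on
  both sides and cancels, leaving \<open>c = c'\<close>; the divisors give the additive equation for
  \<open>u\<close>. Conversely, a solution \<open>u\<close> yields the witness
  \<open>rf_div 1 u\<close>.\<close>

lemma twisted_equiv_rf_div_iff:
  assumes "c \<noteq> 0" "c' \<noteq> 0" "finite {z. e z \<noteq> 0}" "finite {z. e' z \<noteq> 0}"
  shows "sigma.twisted_equiv m (rf_div c e) (rf_div c' e') \<longleftrightarrow> c = c' \<and> shift_equiv m e e'"
proof
  assume "sigma.twisted_equiv m (rf_div c e) (rf_div c' e')"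
  then obtain v where v: "v \<noteq> 0" "int_iter sigma (int m) v * rf_div c' e' = rf_div c e * v"
    by (auto simp: sigma.twisted_equiv_def)
  obtain d u where u: "d \<noteq> 0" "finite {z. u z \<noteq> 0}" "v = rf_div d u"
    using rf_div_surj[OF v(1)] .
  have fs: "finite {z. u (z - 2 * of_nat m) \<noteq> 0}" by (rule finite_supp_shift[OF u(2)])
  have "rf_div (d * c') (\<lambda>z. u (z - 2 * of_nat m) + e' z) = rf_div (c * d) (\<lambda>z. e z + u z)"
    using v(2) by (simp add: u(3) sigma_iter_rf_div rf_div_mult fs assms u(2))
  from rf_div_inject[OF finite_supp_add[OF fs assms(4)] finite_supp_add[OF assms(3) u(2)] _ _ this]
  have "d * c' = c * d" "(\<lambda>z. u (z - 2 * of_nat m) + e' z) = (\<lambda>z. e z + u z)"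
    using u(1) assms by auto
  then show "c = c' \<and> shift_equiv m e e'"
    using u(1,2) by (auto simp: shift_equiv_def fun_eq_iff)
next
  assume "c = c' \<and> shift_equiv m e e'"
  then obtain u where u: "c = c'" "finite {z. u z \<noteq> 0}"
    "\<And>z. u (z - 2 * of_nat m) + e' z = e z + u z"
    unfolding shift_equiv_def by blast
  have fs: "finite {z. u (z - 2 * of_nat m) \<noteq> 0}" by (rule finite_supp_shift[OF u(2)])
  show "sigma.twisted_equiv m (rf_div c e) (rf_div c' e')"
    unfolding sigma.twisted_equiv_def
    by (rule exI[of _ "rf_div 1 u"])
      (simp add: rf_div_nonzero sigma_iter_rf_div rf_div_mult fs assms u)
qed

section \<open>Divisors modulo translation by \<open>2m\<close>\<close>

lemma shift_equiv_refl: "shift_equiv m e e"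
  unfolding shift_equiv_def by (intro exI[of _ "\<lambda>z. 0"]) simp

lemma shift_equiv_sym:
  assumes "shift_equiv m e e'" shows "shift_equiv m e' e"
proof -
  obtain u where "finite {z. u z \<noteq> 0}" "\<And>z. u (z - 2 * of_nat m) + e' z = e z + u z"
    using assms unfolding shift_equiv_def by blast
  then show ?thesis
    unfolding shift_equiv_def by (intro exI[of _ "\<lambda>z. - u z"]) (simp add: algebra_simps)
qed

lemma shift_equiv_trans:
  assumes "shift_equiv m e e'" "shift_equiv m e' e''" shows "shift_equiv m e e''"
proof -
  obtain u v where uv: "finite {z. u z \<noteq> 0}" "\<And>z. u (z - 2 * of_nat m) + e' z = e z + u z"
    "finite {z. v z \<noteq> 0}" "\<And>z. v (z - 2 * of_nat m) + e'' z = e' z + v z"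
    using assms unfolding shift_equiv_def by blast
  have "u (z - 2 * of_nat m) + v (z - 2 * of_nat m) + e'' z = e z + (u z + v z)" for z
    using uv(2)[of z] uv(4)[of z] by linarith
  then show ?thesis
    unfolding shift_equiv_def using finite_supp_add[OF uv(1,3)]
    by (intro exI[of _ "\<lambda>z. u z + v z"]) simp
qed

lemma shift_equiv_add:
  assumes "shift_equiv m e e'" "shift_equiv m f f'"
  shows "shift_equiv m (\<lambda>z. e z + f z) (\<lambda>z. e' z + f' z)"
proof -
  obtain u v where uv: "finite {z. u z \<noteq> 0}" "\<And>z. u (z - 2 * of_nat m) + e' z = e z + u z"
    "finite {z. v z \<noteq> 0}" "\<And>z. v (z - 2 * of_nat m) + f' z = f z + v z"
    using assms unfolding shift_equiv_def by blast
  have "u (z - 2 * of_nat m) + v (z - 2 * of_nat m) + (e' z + f' z) = e z + f z + (u z + v z)" for z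
    using uv(2)[of z] uv(4)[of z] by linarith
  then show ?thesis
    unfolding shift_equiv_def using finite_supp_add[OF uv(1,3)]
    by (intro exI[of _ "\<lambda>z. u z + v z"]) simp
qed

lemma shift_equiv_translate:
  assumes "shift_equiv m e e'"
  shows "shift_equiv m (\<lambda>z. e (z - a)) (\<lambda>z. e' (z - a))"
proof -
  obtain u where u: "finite {z. u z \<noteq> 0}" "\<And>z. u (z - 2 * of_nat m) + e' z = e z + u z"
    using assms unfolding shift_equiv_def by blast
  have "u (z - 2 * of_nat m - a) + e' (z - a) = e (z - a) + u (z - a)" for z
    using u(2)[of "z - a"] by (simp add: algebra_simps)
  then show ?thesis
    unfolding shift_equiv_def using finite_supp_shift[OF u(1)]
    by (intro exI[of _ "\<lambda>z. u (z - a)"]) simp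
qed

lemma shift_equiv_step:
  assumes "finite {z. e z \<noteq> 0}"
  shows "shift_equiv m e (\<lambda>z. e (z - 2 * of_nat m))"
  \<comment> \<open>With \<open>u = - e\<close> both sides of the defining equation are
    zero.\<close>
  unfolding shift_equiv_def using assms by (intro exI[of _ "\<lambda>z. - e z"]) simp

lemma shift_equiv_steps:
  assumes "finite {z. e z \<noteq> 0}"
  shows "shift_equiv m e (\<lambda>z. e (z - 2 * of_nat m * of_int j))"
proof (induction j rule: int_induct[where k = 0])
  case base
  then show ?case by (simp add: shift_equiv_refl)
next
  case (step1 j)
  have "shift_equiv m (\<lambda>z. e (z - 2 * of_nat m * of_int j))
      (\<lambda>z. e (z - 2 * of_nat m - 2 * of_nat m * of_int j))"
    by (rule shift_equiv_step[OF finite_supp_shift[OF assms]])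
  from shift_equiv_trans[OF step1(2) this] show ?case by (simp add: algebra_simps)
next
  case (step2 j)
  have "shift_equiv m (\<lambda>z. e (z - 2 * of_nat m * of_int (j - 1)))
      (\<lambda>z. e (z - 2 * of_nat m - 2 * of_nat m * of_int (j - 1)))"
    by (rule shift_equiv_step[OF finite_supp_shift[OF assms]])
  also have "(\<lambda>z. e (z - 2 * of_nat m - 2 * of_nat m * of_int (j - 1)))
      = (\<lambda>z. e (z - 2 * of_nat m * of_int j))"
    by (simp add: algebra_simps)
  finally show ?case using shift_equiv_trans[OF step2(2) shift_equiv_sym] by blast
qed

text \<open>The divisor of \<^const>\<open>g_param\<close>.\<close>

definition list_div :: "(complex \<Rightarrow> int) list \<Rightarrow> complex \<Rightarrow> int" where
  "list_div zs z = (\<Sum>i<length zs. (zs ! i) (z - 2 * of_nat i))"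

lemma list_div_Nil [simp]: "list_div [] z = 0"
  by (simp add: list_div_def)

lemma list_div_Cons [simp]: "list_div (x # xs) z = x z + list_div xs (z - 2)"
  unfolding list_div_def length_Cons sum.lessThan_Suc_shift by (simp add: algebra_simps)

lemma list_div_append: "list_div (xs @ ys) z = list_div xs z + list_div ys (z - 2 * of_nat (length xs))"
  by (induction xs arbitrary: z) (simp_all add: algebra_simps)

lemma finite_supp_list_div:
  assumes "\<forall>x\<in>set zs. finite {l. x l \<noteq> 0}"
  shows "finite {z. list_div zs z \<noteq> 0}"
  using assms
proof (induction zs)
  case (Cons x xs)
  then show ?case using finite_supp_add[OF _ finite_supp_shift[of "list_div xs" 2], of x] by simp
qed simp

text \<open>One rotation moves the first entry to the end. After a translation by 2 the other
  entries are back in place, and the moved one is displaced by \<open>2m\<close>, which the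
  equivalence ignores.\<close>

lemma shift_equiv_rotate:
  assumes "\<forall>x\<in>set zs. finite {l. x l \<noteq> 0}"
  shows "shift_equiv (length zs) (list_div zs) (\<lambda>z. list_div (rotate k zs) (z - 2 * of_nat k))"
proof (induction k)
  case 0
  then show ?case by (simp add: shift_equiv_refl)
next
  case (Suc k)
  show ?case
  proof (cases "rotate k zs")
    case Nil
    then show ?thesis by (simp add: shift_equiv_refl)
  next
    case (Cons x xs)
    then have len: "length zs = Suc (length xs)" by (metis length_Cons length_rotate)
    have "x \<in> set zs" using Cons by (metis list.set_intros(1) set_rotate)
    then have "shift_equiv (length zs) x (\<lambda>z. x (z - 2 * of_nat (length zs)))"
      using assms by (intro shift_equiv_step) simp
    note step = shift_equiv_add[OF this shift_equiv_refl[of _ "\<lambda>z. list_div xs (z - 2)"]]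
    have "list_div (rotate k zs) = (\<lambda>z. x z + list_div xs (z - 2))"
      "(\<lambda>z. list_div (rotate1 (rotate k zs)) (z - 2))
        = (\<lambda>z. x (z - 2 * of_nat (length zs)) + list_div xs (z - 2))"
      by (simp_all add: Cons list_div_append len fun_eq_iff algebra_simps)
    with step
    have "shift_equiv (length zs) (list_div (rotate k zs)) (\<lambda>z. list_div (rotate1 (rotate k zs)) (z - 2))"
      by simp
    from shift_equiv_trans[OF Suc shift_equiv_translate[OF this]] show ?thesis
      by (simp add: algebra_simps)
  qed
qed

section \<open>Tuples as unique representatives of divisor classes\<close>

lemma Psi_iff:
  "(c, zs) \<in> Psi \<omega> m \<longleftrightarrow> c \<noteq> 0 \<and> length zs = m \<and>
    (\<forall>i<m. \<forall>l. (zs ! i) l \<noteq> 0 \<longrightarrow> \<omega> \<le> Re l \<and> Re l < \<omega> + 2) \<and>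
    (\<forall>i<m. finite {l. (zs ! i) l \<noteq> 0})"
  by (auto simp: Psi_def Omega_def all_set_conv_all_nth)

lemma Psi_supp:
  assumes "(c, zs) \<in> Psi \<omega> m" "i < m" "(zs ! i) l \<noteq> 0"
  shows "\<omega> \<le> Re l \<and> Re l < \<omega> + 2"
  using assms unfolding Psi_iff by blast

lemma Psi_finite: "(c, zs) \<in> Psi \<omega> m \<Longrightarrow> finite {z. list_div zs z \<noteq> 0}"
  by (rule finite_supp_list_div) (auto simp: Psi_def)

text \<open>The substitution \<open>z = l + 2i\<close> turns the \<open>i\<close>-th product into
  the function whose divisor is the \<open>i\<close>-th entry translated by \<open>2i\<close>;
  multiplying the factors adds these divisors.\<close>

lemma g_param_eq:
  assumes "(c, zs) \<in> Psi \<omega> m"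
  shows "g_param \<omega> (c, zs) = rf_div c (list_div zs)"
proof -
  have supp: "{l \<in> Omega \<omega>. (zs ! i) l \<noteq> 0} = {l. (zs ! i) l \<noteq> 0}"
    "finite {l. (zs ! i) l \<noteq> 0}" if "i < m" for i
    using assms that by (auto simp: Psi_iff Omega_def)
  have len: "length zs = m" using assms by (simp add: Psi_iff)
  let ?e = "\<lambda>i z. (zs ! i) (z - 2 * of_nat i)"
  have factor: "(\<Prod>l | l \<in> Omega \<omega> \<and> (zs ! i) l \<noteq> 0.
      (rf_h - rf_const l - rf_const (2 * of_nat i)) powi (zs ! i) l) = rf_div 1 (?e i)"
    if "i < m" for i
    unfolding rf_div_def supp(1)[OF that]
    by (simp, rule prod.reindex_bij_witness[of _ "\<lambda>z. z - 2 * of_nat i" "\<lambda>z. z + 2 * of_nat i"])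
      (auto simp: rf_const_add algebra_simps)
  \<comment> \<open>Finiteness of the support of each partial sum is carried through the induction
    because \<open>rf_div_mult\<close> requires it.\<close>
  have "finite {z. (\<Sum>i<n. ?e i z) \<noteq> 0} \<and> (\<Prod>i<n. rf_div 1 (?e i)) = rf_div 1 (\<lambda>z. \<Sum>i<n. ?e i z)"
    if "n \<le> m" for n
    using that
  proof (induction n)
    case 0
    then show ?case by (simp add: rf_div_zero)
  next
    case (Suc n)
    have fin: "finite {z. ?e n z \<noteq> 0}" using Suc.prems supp(2) by (intro finite_supp_shift) simp
    then show ?case
      using Suc by (simp add: rf_div_mult finite_supp_add)
  qed
  from this[of m] have fin: "finite {z. (\<Sum>i<m. ?e i z) \<noteq> 0}"
    and prod: "(\<Prod>i<m. rf_div 1 (?e i)) = rf_div 1 (\<lambda>z. \<Sum>i<m. ?e i z)" by auto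
  have "g_param \<omega> (c, zs) = rf_const c * rf_div 1 (\<lambda>z. \<Sum>i<m. ?e i z)"
    by (simp add: g_param_def len factor prod)
  also have "\<dots> = rf_div c (list_div zs)"
    by (simp add: rf_div_def list_div_def len)
  finally show ?thesis .
qed

text \<open>The translates of \<open>Omega \<omega>\<close> by \<open>2i\<close> with
  \<open>i < m\<close> tile this strip, which is a fundamental domain for translation by
  \<open>2m\<close>.\<close>

lemma list_div_nonzero_strip:
  assumes "(c, zs) \<in> Psi \<omega> m" "list_div zs z \<noteq> 0"
  shows "\<omega> \<le> Re z \<and> Re z < \<omega> + 2 * real m"
proof -
  obtain i where "i < m" "(zs ! i) (z - 2 * of_nat i) \<noteq> 0"
    using assms unfolding list_div_def Psi_iff by (auto elim: sum.not_neutral_contains_not_neutral)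
  then have "i + 1 \<le> m" "\<omega> \<le> Re z - 2 * real i" "Re z - 2 * real i < \<omega> + 2"
    using Psi_supp[OF assms(1)] by fastforce+
  moreover from this(1) have "real i + 1 \<le> real m" by linarith
  ultimately show ?thesis by simp
qed

text \<open>Different translates of the strip \<open>Omega \<omega>\<close> are disjoint, so in the
  \<open>i\<close>-th one only the \<open>i\<close>-th entry contributes.\<close>

lemma list_div_nth:
  assumes zs: "(c, zs) \<in> Psi \<omega> m" and i: "i < m" and l: "\<omega> \<le> Re l" "Re l < \<omega> + 2"
  shows "list_div zs (l + 2 * of_nat i) = (zs ! i) l"
proof -
  have "(zs ! j) (l + 2 * of_nat i - 2 * of_nat j) = 0" if "j < m" "j \<noteq> i" for j
  proof (rule ccontr)
    assume "(zs ! j) (l + 2 * of_nat i - 2 * of_nat j) \<noteq> 0"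
    then have "\<omega> \<le> Re l + 2 * real i - 2 * real j" "Re l + 2 * real i - 2 * real j < \<omega> + 2"
      using Psi_supp[OF zs that(1)] by fastforce+
    then have "real i < real j + 1" "real j < real i + 1" using l by auto
    then show False using that(2) by linarith
  qed
  then have "list_div zs (l + 2 * of_nat i)
      = (\<Sum>j<m. if j = i then (zs ! i) l else 0)"
    unfolding list_div_def using zs by (intro sum.cong) (auto simp: Psi_iff)
  then show ?thesis using i by simp
qed

lemma finite_supp_const_on_progression:
  fixes u :: "complex \<Rightarrow> int"
  assumes fin: "finite {z. u z \<noteq> 0}" and a: "a \<noteq> 0"
    and const: "\<And>j. u (z + of_nat (Suc j) * a) = u (z + of_nat j * a)"
  shows "u z = 0"
proof (rule ccontr)
  assume uz: "u z \<noteq> 0"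
  have "u (z + of_nat j * a) = u z" for j
    by (induction j) (use const in simp_all)
  then have "range (\<lambda>j. z + of_nat j * a) \<subseteq> {z. u z \<noteq> 0}" using uz by auto
  moreover have "inj (\<lambda>j. z + of_nat j * a)" using a by (auto simp: inj_on_def)
  ultimately show False using fin by (meson finite_subset range_inj_infinite)
qed

text \<open>Outside the strip of width \<open>2m\<close> both divisors vanish, so \<open>u\<close>
  repeats with period \<open>2m\<close> to the right and to the left of it. Finite support then
  gives \<open>u z = 0\<close> and \<open>u (z - 2m) = 0\<close> for \<open>z\<close> in the strip,
  where the divisors must agree; the entries are read off by \<open>list_div_nth\<close>.\<close>

lemma shift_equiv_list_div_unique:
  assumes zs: "(c, zs) \<in> Psi \<omega> m" and ws: "(c', ws) \<in> Psi \<omega> m"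
    and eq: "shift_equiv m (list_div zs) (list_div ws)"
  shows "zs = ws"
proof -
  obtain u where fin: "finite {z. u z \<noteq> 0}"
    and u: "\<And>z. u (z - 2 * of_nat m) + list_div ws z = list_div zs z + u z"
    using eq unfolding shift_equiv_def by blast
  have outside: "u (z - 2 * of_nat m) = u z" if "Re z < \<omega> \<or> \<omega> + 2 * real m \<le> Re z" for z
  proof -
    have "list_div zs z = 0" "list_div ws z = 0"
      using list_div_nonzero_strip[OF zs, of z] list_div_nonzero_strip[OF ws, of z] that
      by linarith+
    then show ?thesis using u[of z] by simp
  qed
  have inside: "list_div zs z = list_div ws z"
    if z: "\<omega> \<le> Re z" "Re z < \<omega> + 2 * real m" for z
  proof -
    have m: "m > 0" using z by (cases m) auto
    have "u z = 0"
    proof (rule finite_supp_const_on_progression[OF fin, of "2 * of_nat m"])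
      fix j
      have "u (z + of_nat (Suc j) * (2 * of_nat m) - 2 * of_nat m)
          = u (z + of_nat (Suc j) * (2 * of_nat m))"
      proof (rule outside)
        have "0 \<le> real j * (real m * 2)" by simp
        then have "\<omega> \<le> Re z + real j * (real m * 2)" using z(1) by linarith
        then show "Re (z + of_nat (Suc j) * (2 * of_nat m)) < \<omega> \<or>
            \<omega> + 2 * real m \<le> Re (z + of_nat (Suc j) * (2 * of_nat m))"
          by (simp add: algebra_simps)
      qed
      then show "u (z + of_nat (Suc j) * (2 * of_nat m)) = u (z + of_nat j * (2 * of_nat m))"
        by (simp add: algebra_simps)
    qed (use m in simp)
    moreover have "u (z - 2 * of_nat m) = 0"
    proof (rule finite_supp_const_on_progression[OF fin, of "- 2 * of_nat m"])
      fix j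
      have "u (z - 2 * of_nat m + of_nat j * (- 2 * of_nat m) - 2 * of_nat m)
          = u (z - 2 * of_nat m + of_nat j * (- 2 * of_nat m))"
      proof (rule outside)
        have "0 \<le> real j * (2 * real m)" by simp
        then have "Re z - 2 * real m - real j * (2 * real m) < \<omega>" using z(2) by linarith
        then show "Re (z - 2 * of_nat m + of_nat j * (- 2 * of_nat m)) < \<omega> \<or>
            \<omega> + 2 * real m \<le> Re (z - 2 * of_nat m + of_nat j * (- 2 * of_nat m))"
          by simp
      qed
      then show "u (z - 2 * of_nat m + of_nat (Suc j) * (- 2 * of_nat m))
          = u (z - 2 * of_nat m + of_nat j * (- 2 * of_nat m))"
        by (simp add: algebra_simps)
    qed (use m in simp)
    ultimately show ?thesis using u[of z] by simp
  qed
  have len: "length zs = m" "length ws = m" using zs ws by (auto simp: Psi_iff)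
  show ?thesis
  proof (rule nth_equalityI)
    fix i assume "i < length zs"
    then have i: "i < m" using len by simp
    show "zs ! i = ws ! i"
    proof
      fix l
      show "(zs ! i) l = (ws ! i) l"
      proof (cases "\<omega> \<le> Re l \<and> Re l < \<omega> + 2")
        case True
        have "real i + 1 \<le> real m" using i by linarith
        then have "list_div zs (l + 2 * of_nat i) = list_div ws (l + 2 * of_nat i)"
          using True by (intro inside) auto
        then show ?thesis using True list_div_nth[OF zs i] list_div_nth[OF ws i] by simp
      next
        case False
        then have "(zs ! i) l = 0" "(ws ! i) l = 0" using zs ws i unfolding Psi_iff by blast+
        then show ?thesis by simp
      qed
    qed
  qed (simp add: len)
qed

text \<open>The equivalence is compatible with addition, so it is enough to represent divisors
  supported at one point and to add the tuples entrywise.\<close>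

lemma shift_equiv_list_div_exists:
  assumes m: "m > 0" and c: "c \<noteq> 0" and e: "finite {z. e z \<noteq> 0}"
  obtains zs where "(c, zs) \<in> Psi \<omega> m" "shift_equiv m e (list_div zs)"
proof -
  have single: "\<exists>zs. (c, zs) \<in> Psi \<omega> m \<and> shift_equiv m (\<lambda>w. if w = z then n else 0) (list_div zs)"
    for z and n :: int
  proof -
    \<comment> \<open>Thus \<open>z = l + 2k\<close> with \<open>l\<close> in
      \<open>Omega \<omega>\<close>. The remainder of \<open>k\<close> modulo \<open>m\<close>
      selects the entry; the quotient amounts to a translation by a multiple of \<open>2m\<close>,
      absorbed by \<open>shift_equiv_steps\<close>.\<close>
    define k where "k = \<lfloor>(Re z - \<omega>) / 2\<rfloor>"
    define l where "l = z - 2 * of_int k"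
    define i where "i = nat (k mod int m)"
    have k: "of_int k \<le> (Re z - \<omega>) / 2" "(Re z - \<omega>) / 2 < of_int k + 1"
      unfolding k_def by linarith+
    have l: "\<omega> \<le> Re l" "Re l < \<omega> + 2" using k by (auto simp: l_def field_simps)
    have i: "i < m" using m by (simp add: i_def nat_less_iff)
    have "k = int i + int m * (k div int m)" using m by (simp add: i_def)
    then have "(of_int k :: complex) = of_int (int i + int m * (k div int m))" by simp
    then have z: "z = l + 2 * of_nat i - 2 * of_nat m * of_int (- (k div int m))"
      by (simp add: l_def algebra_simps)
    define zs where "zs = (replicate m (\<lambda>w. 0))[i := (\<lambda>w. if w = l then n else 0)]"
    have nth: "zs ! j = (if j = i then (\<lambda>w. if w = l then n else 0) else (\<lambda>w. 0))" if "j < m" for j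
      using that i by (simp add: zs_def)
    have len: "length zs = m" by (simp add: zs_def)
    have "(c, zs) \<in> Psi \<omega> m"
      using c l nth by (auto simp: Psi_iff len split: if_splits)
    moreover have "list_div zs w = (if w = l + 2 * of_nat i then n else 0)" for w
    proof -
      have "list_div zs w = (\<Sum>j<m. if j = i then (if w - 2 * of_nat i = l then n else 0) else 0)"
        unfolding list_div_def len by (intro sum.cong) (auto simp: nth)
      then show ?thesis using i by (auto simp: algebra_simps)
    qed
    then have zs_eq: "list_div zs = (\<lambda>w. if w = l + 2 * of_nat i then n else 0)" by blast
    moreover have "shift_equiv m (list_div zs) (\<lambda>w. list_div zs (w - 2 * of_nat m * of_int (k div int m)))"
      by (rule shift_equiv_steps) (simp add: zs_eq)
    moreover have "(\<lambda>w. list_div zs (w - 2 * of_nat m * of_int (k div int m)))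
        = (\<lambda>w. if w = z then n else 0)"
      by (auto simp: zs_eq z algebra_simps)
    ultimately show ?thesis using shift_equiv_sym[of m "list_div zs"] by auto
  qed
  have "\<exists>zs. (c, zs) \<in> Psi \<omega> m \<and> shift_equiv m e (list_div zs)"
    if "finite A" "{z. e z \<noteq> 0} \<subseteq> A" for A e
    using that
  proof (induction A arbitrary: e rule: finite_induct)
    case empty
    \<comment> \<open>The zero divisor is written as a point divisor of multiplicity 0, so that
      \<open>single\<close> supplies a tuple.\<close>
    then have "e = (\<lambda>w. if w = 0 then 0 else 0)" by auto
    then show ?case using single[of 0 0] by simp
  next
    case (insert z A)
    have "{w. (e(z := 0)) w \<noteq> 0} \<subseteq> A" using insert.prems by auto
    from insert.IH[OF this] obtain xs
      where xs: "(c, xs) \<in> Psi \<omega> m" "shift_equiv m (e(z := 0)) (list_div xs)" by blast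
    obtain ys where ys: "(c, ys) \<in> Psi \<omega> m"
      "shift_equiv m (\<lambda>w. if w = z then e z else 0) (list_div ys)"
      using single by blast
    define zs where "zs = map (\<lambda>i w. (xs ! i) w + (ys ! i) w) [0..<m]"
    have len: "length xs = m" "length ys = m" "length zs = m"
      using xs ys by (auto simp: Psi_iff zs_def)
    have nth: "zs ! i = (\<lambda>w. (xs ! i) w + (ys ! i) w)" if "i < m" for i
      using that by (simp add: zs_def)
    have "\<omega> \<le> Re l \<and> Re l < \<omega> + 2" if "i < m" "(zs ! i) l \<noteq> 0" for i l
    proof -
      have "(xs ! i) l \<noteq> 0 \<or> (ys ! i) l \<noteq> 0" using that nth by auto
      then show ?thesis using xs(1) ys(1) that(1) unfolding Psi_iff by blast
    qed
    moreover have "finite {l. (zs ! i) l \<noteq> 0}" if "i < m" for i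
      unfolding nth[OF that] using xs(1) ys(1) that by (intro finite_supp_add) (auto simp: Psi_iff)
    ultimately have "(c, zs) \<in> Psi \<omega> m" using c len by (auto simp: Psi_iff)
    moreover have "list_div zs = (\<lambda>w. list_div xs w + list_div ys w)"
      by (simp add: list_div_def len nth sum.distrib fun_eq_iff)
    moreover have "e = (\<lambda>w. (e(z := 0)) w + (if w = z then e z else 0))" by auto
    ultimately show ?case using shift_equiv_add[OF xs(2) ys(2)] by metis
  qed
  then show ?thesis using that e by blast
qed


section \<open>Binomials over \<open>\<complex>(h)\<close>\<close>

lemma sl_var_power: "sl_var [^]\<^bsub>R_alg\<^esub> n = sl_monom 1 (int n)"
proof (induction n)
  case 0
  then show ?case by (simp add: sigma.L_one)
next
  case (Suc n)
  have "sl_var = (sl_monom 1 1 :: int \<Rightarrow> ratfun)" by (simp add: sl_var_def sl_monom_def)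
  then have "sl_var [^]\<^bsub>R_alg\<^esub> Suc n = sl_monom 1 (int n) \<otimes>\<^bsub>R_alg\<^esub> sl_monom 1 1"
    using Suc by simp
  also have "\<dots> = sl_monom 1 (int (Suc n))"
    by (rule ext, simp add: sigma.mult_monom_left) (auto simp: sl_monom_def)
  finally show ?case .
qed

lemma binom_eq_sl_binom: "binom m b = sl_binom m b"
proof -
  have const: "sl_const b = sl_monom b 0" by (simp add: sl_const_def sl_monom_def)
  show ?thesis
    unfolding binom_def sl_var_power const
      sigma.L_minus[OF sigma.monom_carrier sigma.monom_carrier]
    by (auto simp: sl_binom_def sl_monom_def)
qed

section \<open>Orbits, rotations and twisted equivalence\<close>

lemma psi_orbit_eq:
  assumes "m > 0" "(c, zs) \<in> Psi \<omega> m"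
  shows "psi_orbit \<omega> m (c, zs) = (\<lambda>k. (c, rotate k zs)) ` {..<m}"
proof -
  have "psi_orbit \<omega> m (c, zs) = (\<lambda>k. psi_act \<omega> m k (c, zs)) ` {0..<int m}"
    using assms(1) by (auto simp: psi_orbit_def orbit_def carrier_integer_mod_group)
  also have "{0..<int m} = int ` {..<m}"
    by (simp add: image_int_atLeastLessThan atLeast0LessThan[symmetric])
  finally show ?thesis
    using assms(2) by (simp add: image_image psi_act_def)
qed

lemma psi_regular_iff:
  assumes m: "m > 0" and zs: "(c, zs) \<in> Psi \<omega> m"
  shows "psi_regular \<omega> m (c, zs) \<longleftrightarrow> (\<forall>k. 0 < k \<longrightarrow> k < m \<longrightarrow> rotate k zs \<noteq> zs)"
proof -
  have len: "length zs = m" using zs by (simp add: Psi_iff)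
  have "psi_regular \<omega> m (c, zs) \<longleftrightarrow> inj_on (\<lambda>k. (c, rotate k zs)) {..<m}"
    unfolding psi_regular_def psi_orbit_eq[OF m zs] by (simp add: inj_on_iff_eq_card)
  also have "\<dots> \<longleftrightarrow> (\<forall>k. 0 < k \<longrightarrow> k < m \<longrightarrow> rotate k zs \<noteq> zs)"
  proof
    assume inj: "inj_on (\<lambda>k. (c, rotate k zs)) {..<m}"
    have "rotate k zs \<noteq> zs" if "0 < k" "k < m" for k
      using inj_onD[OF inj, of k 0] that m by auto
    then show "\<forall>k. 0 < k \<longrightarrow> k < m \<longrightarrow> rotate k zs \<noteq> zs" by blast
  next
    assume *: "\<forall>k. 0 < k \<longrightarrow> k < m \<longrightarrow> rotate k zs \<noteq> zs"
    have "rotate j zs \<noteq> rotate k zs" if "j < k" "k < m" for j k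
    proof
      assume "rotate j zs = rotate k zs"
      \<comment> \<open>A further rotation by \<open>m - j\<close> completes the full turn on the
        left, so a coincidence of two rotations becomes a nontrivial rotation fixing
        \<open>zs\<close>.\<close>
      then have "rotate (m - j) (rotate j zs) = rotate (m - j) (rotate k zs)" by simp
      moreover have "rotate (m - j) (rotate j zs) = zs"
        using that len by (simp add: rotate_rotate rotate_id)
      moreover have "m - j + k = (k - j) + m" using that by simp
      then have "rotate (m - j) (rotate k zs) = rotate (k - j) zs"
        using len by (simp add: rotate_rotate) (simp add: rotate_id flip: rotate_rotate)
      moreover have "0 < k - j" "k - j < m" using that by simp_all
      ultimately show False using * by metis
    qed
    then show "inj_on (\<lambda>k. (c, rotate k zs)) {..<m}"
      by (intro inj_onI) (metis lessThan_iff linorder_neqE_nat prod.inject)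
  qed
  finally show ?thesis .
qed

lemma Psi_rotate: "(c, zs) \<in> Psi \<omega> m \<Longrightarrow> (c, rotate k zs) \<in> Psi \<omega> m"
  by (simp add: Psi_def)

text \<open>Applying \<open>\<sigma>^k\<close> translates the divisor by \<open>2k\<close>, which by
  \<open>shift_equiv_rotate\<close> undoes \<open>k\<close> rotations. Since \<open>m\<close>
  rotations are the identity, the class is represented by \<open>rotate (m - k) ws\<close>, and
  uniqueness of representatives concludes.\<close>

lemma twisted_equiv_g_param_iff:
  assumes zs: "(c, zs) \<in> Psi \<omega> m" and ws: "(c', ws) \<in> Psi \<omega> m" and k: "k \<le> m"
  shows "sigma.twisted_equiv m (g_param \<omega> (c, zs)) (int_iter sigma (int k) (g_param \<omega> (c', ws)))
    \<longleftrightarrow> c = c' \<and> zs = rotate (m - k) ws"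
proof -
  let ?us = "rotate (m - k) ws"
  let ?e = "\<lambda>z. list_div ws (z - 2 * of_nat k)"
  have len: "length ws = m" using ws by (simp add: Psi_iff)
  have us: "(c', ?us) \<in> Psi \<omega> m" using ws by (rule Psi_rotate)
  have "\<forall>x\<in>set ?us. finite {l. x l \<noteq> 0}" using us by (auto simp: Psi_def)
  from shift_equiv_rotate[OF this, of k] have us_equiv: "shift_equiv m (list_div ?us) ?e"
    using k len by (simp add: rotate_rotate rotate_id)
  have "sigma.twisted_equiv m (g_param \<omega> (c, zs)) (int_iter sigma (int k) (g_param \<omega> (c', ws)))
      \<longleftrightarrow> c = c' \<and> shift_equiv m (list_div zs) ?e"
    unfolding g_param_eq[OF zs] g_param_eq[OF ws] sigma_iter_rf_div
    using zs ws finite_supp_shift[OF Psi_finite[OF ws]]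
    by (intro twisted_equiv_rf_div_iff) (auto simp: Psi_finite[OF zs] Psi_iff)
  also have "shift_equiv m (list_div zs) ?e \<longleftrightarrow> zs = ?us"
    using us_equiv shift_equiv_list_div_unique[OF zs us] shift_equiv_sym shift_equiv_trans
    by blast
  finally show ?thesis .
qed

lemma g_param_nonzero: "(c, zs) \<in> Psi \<omega> m \<Longrightarrow> g_param \<omega> (c, zs) \<noteq> 0"
  using rf_div_nonzero[of c] by (simp add: g_param_eq) (simp add: Psi_iff)

section \<open>Irreducibility, similarity and existence of parameters\<close>

lemma left_irreducible_regular:
  assumes m: "m > 0" and zs: "(c, zs) \<in> Psi \<omega> m"
    and reg: "\<And>k. 0 < k \<Longrightarrow> k < m \<Longrightarrow> rotate k zs \<noteq> zs"
  shows "left_irreducible R_alg (sl_binom m (g_param \<omega> (c, zs)))"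
  unfolding sigma.left_irreducible_binom_iff[OF m]
proof (rule sigma.maximal_left_ideal_binom[OF m g_param_nonzero[OF zs]])
  fix k :: int assume "0 < k" "k < int m"
  then obtain n where "k = int n" "0 < n" "n < m" by (metis of_nat_0_less_iff of_nat_less_iff zero_less_imp_eq_int)
  \<comment> \<open>An equivalence would make \<open>zs\<close> invariant under rotation by
    \<open>m - n\<close>, which is again strictly between 0 and \<open>m\<close>.\<close>
  then show "\<not> sigma.twisted_equiv m (g_param \<omega> (c, zs)) (int_iter sigma k (g_param \<omega> (c, zs)))"
    using twisted_equiv_g_param_iff[OF zs zs, of n] reg[of "m - n"] by auto
qed

lemma concat_replicate_Psi:
  assumes "(c, concat (replicate r ws)) \<in> Psi \<omega> m" "r > 0"
  shows "\<forall>x\<in>set ws. finite {l. x l \<noteq> 0}"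
  using assms by (auto simp: Psi_def)

text \<open>Take an \<open>r\<close>-th root \<open>b\<close> of \<open>c\<close>. The function with
  constant \<open>b\<close> and divisor \<open>list_div ws\<close> has the parameter function as its
  norm with \<open>r\<close> factors, so \<open>x^d\<close> minus it is a right factor, where
  \<open>d\<close> is the period.\<close>

lemma not_left_irreducible_periodic:
  assumes zs: "(c, concat (replicate r ws)) \<in> Psi \<omega> m" and r: "r > 1" and ws: "ws \<noteq> []"
  shows "\<not> left_irreducible R_alg (sl_binom m (g_param \<omega> (c, concat (replicate r ws))))"
proof -
  define d where "d = length ws"
  have c: "c \<noteq> 0" using zs by (simp add: Psi_iff)
  have m: "m = r * d" using zs by (simp add: Psi_iff d_def length_concat sum_list_replicate)
  have d: "0 < d" "d < m" using ws r by (simp_all add: d_def m)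
  obtain b where b: "b ^ r = c" using nth_root_exists[of r c] r by auto
  have "b \<noteq> 0" using b c r by (auto simp: power_0_left)
  have fin_ws: "\<forall>x\<in>set ws. finite {l. x l \<noteq> 0}"
    using concat_replicate_Psi[OF zs] r by simp
  have fin: "finite {z. list_div (concat (replicate j ws)) z \<noteq> 0}" for j
    by (rule finite_supp_list_div) (use fin_ws in auto)
  define N where "N j = rf_div (b ^ j) (list_div (concat (replicate j ws)))" for j
  have "sl_binom (r * d) (N r) \<in> left_principal R_alg (sl_binom d (rf_div b (list_div ws)))"
  proof (rule sigma.binom_norm_mem)
    show "N 0 = 1" by (simp add: N_def rf_div_def)
    \<comment> \<open>\<open>\<sigma>^d\<close> moves the first \<open>j\<close> copies of
      \<open>ws\<close> up by \<open>d\<close> positions, which frees the initial ones for a new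
      copy; the constants multiply to \<open>b^(j+1)\<close>.\<close>
    show "N (Suc j) = int_iter sigma (int d) (N j) * rf_div b (list_div ws)" for j
      unfolding N_def sigma_iter_rf_div
      using finite_supp_shift[OF fin[of j]] finite_supp_list_div[OF fin_ws]
      by (subst rf_div_mult) (auto simp: d_def list_div_append fun_eq_iff algebra_simps intro!: arg_cong2[where f = rf_div])
  qed
  moreover have "N r = g_param \<omega> (c, concat (replicate r ws))"
    by (simp add: N_def g_param_eq[OF zs] b)
  ultimately show ?thesis
    using sigma.not_left_irreducible_binom[OF d g_param_nonzero[OF zs], of "rf_div b (list_div ws)"]
      \<open>b \<noteq> 0\<close> by (simp add: m rf_div_nonzero)
qed

lemma left_irreducible_iff_regular:
  assumes m: "m > 0" and zs: "(c, zs) \<in> Psi \<omega> m"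
  shows "left_irreducible R_alg (binom m (g_param \<omega> (c, zs))) \<longleftrightarrow> psi_regular \<omega> m (c, zs)"
proof (cases "\<exists>k. 0 < k \<and> k < m \<and> rotate k zs = zs")
  case False
  then show ?thesis
    using left_irreducible_regular[OF m zs] psi_regular_iff[OF m zs]
    by (auto simp: binom_eq_sl_binom)
next
  case True
  then obtain k where k: "0 < k" "k < m" "rotate k zs = zs" by blast
  have len: "length zs = m" using zs by (simp add: Psi_iff)
  \<comment> \<open>The rotation swaps the two pieces of \<open>zs\<close>, so they commute as
    words; commuting words are powers of a common word, the period \<open>ws\<close>.\<close>
  have "drop k zs @ take k zs = take k zs @ drop k zs"
    using k len by (simp add: rotate_drop_take)
  from comm_append_are_replicate[OF this] obtain p q ws
    where ws: "concat (replicate p ws) = drop k zs" "concat (replicate q ws) = take k zs" by blast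
  have "zs = concat (replicate (q + p) ws)"
    by (simp add: replicate_add ws)
  moreover have "drop k zs \<noteq> []" "take k zs \<noteq> []" using k len by auto
  then have "p > 0" "q > 0" "ws \<noteq> []" using ws by (auto intro!: Nat.gr0I)
  ultimately have "\<not> left_irreducible R_alg (sl_binom m (g_param \<omega> (c, zs)))"
    using not_left_irreducible_periodic[of c "q + p" ws \<omega> m] zs by simp
  then show ?thesis
    using k psi_regular_iff[OF m zs] by (auto simp: binom_eq_sl_binom)
qed

lemma left_similar_iff_orbit:
  assumes m: "m > 0" and zs: "(c, zs) \<in> Psi \<omega> m" and ws: "(c', ws) \<in> Psi \<omega> m"
    and reg: "psi_regular \<omega> m (c, zs)" "psi_regular \<omega> m (c', ws)"
  shows "left_similar R_alg (binom m (g_param \<omega> (c, zs))) (binom m (g_param \<omega> (c', ws)))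
    \<longleftrightarrow> (c, zs) \<in> psi_orbit \<omega> m (c', ws)"
proof -
  have len: "length ws = m" using ws by (simp add: Psi_iff)
  have "left_similar R_alg (binom m (g_param \<omega> (c, zs))) (binom m (g_param \<omega> (c', ws)))
    \<longleftrightarrow> (\<exists>k. 0 \<le> k \<and> k < int m \<and> sigma.twisted_equiv m (g_param \<omega> (c, zs))
          (int_iter sigma k (g_param \<omega> (c', ws))))"
    unfolding binom_eq_sl_binom
    using reg left_irreducible_iff_regular[OF m zs] left_irreducible_iff_regular[OF m ws]
    by (intro sigma.left_similar_binom_iff[OF m g_param_nonzero[OF ws]]) (simp_all add: binom_eq_sl_binom)
  also have "\<dots> \<longleftrightarrow> (\<exists>k<m. sigma.twisted_equiv m (g_param \<omega> (c, zs))
          (int_iter sigma (int k) (g_param \<omega> (c', ws))))"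
    by (metis nonneg_int_cases of_nat_0_le_iff of_nat_less_iff)
  also have "\<dots> \<longleftrightarrow> (\<exists>k<m. c = c' \<and> zs = rotate (m - k) ws)"
    using twisted_equiv_g_param_iff[OF zs ws] by (metis less_imp_le)
  \<comment> \<open>The map sending \<open>k\<close> to \<open>m - k\<close> modulo \<open>m\<close>
    permutes the indices; \<open>k = 0\<close> corresponds to itself because a rotation by
    \<open>m\<close> is trivial.\<close>
  also have "\<dots> \<longleftrightarrow> (\<exists>k<m. c = c' \<and> zs = rotate k ws)"
  proof (intro iffI; elim exE conjE)
    fix k assume "k < m" "c = c'" "zs = rotate (m - k) ws"
    then show "\<exists>k<m. c = c' \<and> zs = rotate k ws"
      using m len rotate_conv_mod[of "m - k" ws] by (intro exI[of _ "(m - k) mod m"]) simp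
  next
    fix k assume "k < m" "c = c'" "zs = rotate k ws"
    then show "\<exists>k<m. c = c' \<and> zs = rotate (m - k) ws"
      using m len by (cases "k = 0") (auto intro: exI[of _ "m - k"] exI[of _ 0])
  qed
  also have "\<dots> \<longleftrightarrow> (c, zs) \<in> psi_orbit \<omega> m (c', ws)"
    by (auto simp: psi_orbit_eq[OF m ws])
  finally show ?thesis .
qed

text \<open>Irreducibility forces \<open>b\<close> to be nonzero, so \<open>b\<close> has a divisor,
  whose class contains that of a tuple with the same constant. The resulting twisted equivalence
  transfers irreducibility and, with \<open>k = 0\<close>, gives similarity.\<close>

lemma left_similar_exists:
  assumes m: "m > 0" and irr: "left_irreducible R_alg (binom m b)"
  shows "\<exists>\<zeta>\<in>Psi \<omega> m. left_similar R_alg (binom m b) (binom m (g_param \<omega> \<zeta>))"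
proof -
  have irr': "left_irreducible R_alg (sl_binom m b)" using irr by (simp add: binom_eq_sl_binom)
  obtain c e where c: "c \<noteq> 0" and e: "finite {z. e z \<noteq> 0}" and b: "b = rf_div c e"
    using rf_div_surj[OF sigma.left_irreducible_binom_nonzero[OF m irr']] .
  obtain zs where zs: "(c, zs) \<in> Psi \<omega> m" "shift_equiv m e (list_div zs)"
    using shift_equiv_list_div_exists[OF m c e] .
  have eq: "sigma.twisted_equiv m b (g_param \<omega> (c, zs))"
    using twisted_equiv_rf_div_iff[OF c c e Psi_finite[OF zs(1)]] zs by (simp add: b g_param_eq)
  then have "\<exists>k. 0 \<le> k \<and> k < int m \<and>
      sigma.twisted_equiv m b (int_iter sigma k (g_param \<omega> (c, zs)))"
    using m by (intro exI[of _ 0]) simp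
  then have "left_similar R_alg (sl_binom m b) (sl_binom m (g_param \<omega> (c, zs)))"
    using sigma.left_similar_binom_iff[OF m g_param_nonzero[OF zs(1)] irr'
      sigma.left_irreducible_binom_twisted_equiv[OF irr' eq]] by simp
  then show ?thesis using zs(1) by (auto simp: binom_eq_sl_binom)
qed

theorem theorem12:
  fixes m :: nat and \<omega> :: real
  assumes "m > 0"
  shows "(\<forall>\<zeta>\<in>Psi \<omega> m.
            left_irreducible R_alg (binom m (g_param \<omega> \<zeta>)) \<longleftrightarrow> psi_regular \<omega> m \<zeta>)
       \<and> (\<forall>\<zeta>\<in>Psi \<omega> m. \<forall>\<zeta>'\<in>Psi \<omega> m.
            psi_regular \<omega> m \<zeta> \<longrightarrow> psi_regular \<omega> m \<zeta>' \<longrightarrow>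
            (left_similar R_alg (binom m (g_param \<omega> \<zeta>)) (binom m (g_param \<omega> \<zeta>'))
               \<longleftrightarrow> \<zeta> \<in> psi_orbit \<omega> m \<zeta>'))
       \<and> (\<forall>\<beta>. left_irreducible R_alg (binom m \<beta>) \<longrightarrow>
            (\<exists>\<zeta>\<in>Psi \<omega> m. left_similar R_alg (binom m \<beta>) (binom m (g_param \<omega> \<zeta>))))"
  using left_irreducible_iff_regular[OF assms, where \<omega> = \<omega>]
    left_similar_iff_orbit[OF assms, where \<omega> = \<omega>]
    left_similar_exists[OF assms, where \<omega> = \<omega>]
  by auto

end
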